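(* Let $n\ge 2$ and consider the evolution equation with constant separant $$\frac{\partial u}{\partial t}=u_n+f(u,u_1,\dots,u_{n-1}).$$ Let $S$ be the set of all its symmetries and let $S^{(n-1)}=\{G\in S:\ {\rm ord}\,G\le n-1\}$. (i) If all elements of $S^{(n-1)}$ are polynomial in $t$, then every $G\in S$ is polynomial in $t$. (ii) If all elements of $S^{(n-1)}$ are linear combinations of quasipolynomials in $t$, then every $G\in S$ is a linear combination of quasipolynomials in $t$.
   Context: Here $u=u(x,t)$ is a scalar unknown, $u_l=\partial^l u/\partial x^l$ and $u_0\equiv u$. The quantities $x,t,u,u_1,u_2,\dots$ are treated as independent variables (jet coordinates). All functions are sufficiently smooth, and each depends on finitely many of these variables. Write $F=u_n+f(u,\dots,u_{n-1})$; thus $F$ does not depend explicitly on $x$ or $t$. The total $x$-derivative is $D=\frac{\partial}{\partial x}+\sum_{i\ge 0}u_{i+1}\frac{\partial}{\partial u_i}$. For a function $h(x,t,u,\dots,u_r)$ put $h_*=\sum_{i=0}^{r}\frac{\partial h}{\partial u_i}D^i$. The bracket is $\{h,r\}=h_*(r)-r_*(h)$. A symmetry of the equation $\partial u/\partial t=F$ is a function $G(x,t,u,u_1,\dots,u_k)$, for some finite $k$, such that the equation $\partial u/\partial\tau=G$ is compatible with $\partial u/\partial t=F$; equivalently, $\partial G/\partial t=\{F,G\}$, where $\partial/\partial t$ is the partial derivative with respect to the explicit variable $t$. The order ${\rm ord}\,G$ is the largest $k$ such that $\partial G/\partial u_k\ne 0$. If $G$ does not depend on $u,u_1,\dots$,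 then ${\rm ord}\,G=0$. A quasipolynomial in $t$ is a product $\exp(\lambda t)P(t)$, where $\lambda\in\mathbb{C}$ and $P$ is a polynomial. A symmetry is polynomial in $t$ (respectively, a linear combination of quasipolynomials in $t$) if it is a polynomial in $t$ (respectively, a finite linear combination of quasipolynomials in $t$) with coefficients that are $t$-independent functions of $x,u,u_1,\dots$. Functions are allowed to be complex-valued. *)

theory Defs
  imports "HOL-Analysis.Analysis" "HOL-Computational_Algebra.Polynomial"
begin

text \<open>
  A point of the jet space assigns a real value to each of the independent variables
  \<open>x\<close>, \<open>t\<close>, \<open>u\<^sub>0\<close>, \<open>u\<^sub>1\<close>, \<dots>; the space of points carries the product topology. Functions are
  complex-valued and considered on a domain \<open>M\<close>; their values off \<open>M\<close> are irrelevant.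
\<close>

datatype jet_var = Jx | Jt | Ju nat

type_synonym jet_point = "jet_var \<Rightarrow> real"

type_synonym jet_fun = "jet_point \<Rightarrow> complex"

definition jet_domain :: "real set \<Rightarrow> real set \<Rightarrow> (nat \<Rightarrow> real) set \<Rightarrow> jet_point set" where
  "jet_domain I J \<Omega> = {p. p Jx \<in> I \<and> p Jt \<in> J \<and> (\<lambda>i. p (Ju i)) \<in> \<Omega>}"

definition depends_only :: "jet_point set \<Rightarrow> jet_var set \<Rightarrow> jet_fun \<Rightarrow> bool" where
  "depends_only M V h \<longleftrightarrow> (\<forall>p\<in>M. \<forall>q\<in>M. (\<forall>v\<in>V. p v = q v) \<longrightarrow> h p = h q)"

definition pd :: "jet_var \<Rightarrow> jet_fun \<Rightarrow> jet_fun" where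
  "pd v h p = vector_derivative (\<lambda>s. h (p(v := s))) (at (p v))"

text \<open>All iterated partial derivatives exist and are continuous.\<close>

definition jet_smooth :: "jet_point set \<Rightarrow> jet_fun \<Rightarrow> bool" where
  "jet_smooth M h \<longleftrightarrow>
     (\<forall>vs. continuous_on M (foldr pd vs h) \<and>
           (\<forall>v. \<forall>p\<in>M. (\<lambda>s. foldr pd vs h (p(v := s))) differentiable (at (p v))))"

definition jet_function :: "jet_point set \<Rightarrow> jet_fun \<Rightarrow> bool" where
  "jet_function M h \<longleftrightarrow> jet_smooth M h \<and> (\<exists>V. finite V \<and> depends_only M V h)"

text \<open>
  A function depending on finitely many variables has only finitely many non-zero partial
  derivatives at each point, so the sums over \<open>i \<ge> 0\<close> below may be restricted to these.
\<close>

definition total_D :: "jet_fun \<Rightarrow> jet_fun" where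
  "total_D h p = pd Jx h p
     + (\<Sum>i | pd (Ju i) h p \<noteq> 0. of_real (p (Ju (Suc i))) * pd (Ju i) h p)"

definition linearization :: "jet_fun \<Rightarrow> jet_fun \<Rightarrow> jet_fun" where
  "linearization h r p = (\<Sum>i | pd (Ju i) h p \<noteq> 0. pd (Ju i) h p * (total_D ^^ i) r p)"

definition jet_bracket :: "jet_fun \<Rightarrow> jet_fun \<Rightarrow> jet_fun" where
  "jet_bracket h r p = linearization h r p - linearization r h p"

definition jet_ord :: "jet_point set \<Rightarrow> jet_fun \<Rightarrow> nat" where
  "jet_ord M G = (if \<exists>k. \<exists>p\<in>M. pd (Ju k) G p \<noteq> 0
                  then (GREATEST k. \<exists>p\<in>M. pd (Ju k) G p \<noteq> 0) else 0)"

definition symmetries :: "jet_point set \<Rightarrow> jet_fun \<Rightarrow> jet_fun set" where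
  "symmetries M F = {G. jet_function M G \<and> (\<forall>p\<in>M. pd Jt G p = jet_bracket F G p)}"

definition symmetries_upto :: "jet_point set \<Rightarrow> jet_fun \<Rightarrow> nat \<Rightarrow> jet_fun set" where
  "symmetries_upto M F k = {G \<in> symmetries M F. jet_ord M G \<le> k}"

definition time_coefficient :: "jet_point set \<Rightarrow> jet_fun \<Rightarrow> bool" where
  "time_coefficient M c \<longleftrightarrow> jet_function M c \<and> depends_only M (- {Jt}) c"

definition polynomial_in_t :: "jet_point set \<Rightarrow> jet_fun \<Rightarrow> bool" where
  "polynomial_in_t M G \<longleftrightarrow>
     (\<exists>(d::nat) c. (\<forall>j\<le>d. time_coefficient M (c j)) \<and>
        (\<forall>p\<in>M. G p = (\<Sum>j\<le>d. c j p * of_real (p Jt) ^ j)))"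

definition quasipolynomial :: "(real \<Rightarrow> complex) \<Rightarrow> bool" where
  "quasipolynomial q \<longleftrightarrow>
     (\<exists>(\<mu>::complex) (P::complex poly). \<forall>t. q t = exp (\<mu> * of_real t) * poly P (of_real t))"

definition quasipolynomial_combination_in_t :: "jet_point set \<Rightarrow> jet_fun \<Rightarrow> bool" where
  "quasipolynomial_combination_in_t M G \<longleftrightarrow>
     (\<exists>(m::nat) c q. (\<forall>j<m. time_coefficient M (c j) \<and> quasipolynomial (q j)) \<and>
        (\<forall>p\<in>M. G p = (\<Sum>j<m. c j p * q j (p Jt))))"

definition constant_separant_rhs :: "nat \<Rightarrow> jet_fun \<Rightarrow> jet_fun" where
  "constant_separant_rhs n f p = of_real (p (Ju n)) + f p"

end

theory Submission
  imports Defs "HOL-Library.Function_Algebras"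
begin

text \<open>
  Let \<open>G\<close> be a symmetry of order \<open>k \<ge> n\<close> and \<open>g = \<partial>G/\<partial>u\<^sub>k\<close>. Linearizing \<open>\<partial>G/\<partial>t = {F, G}\<close>, the
  coefficient of \<open>D\<^sup>k\<^sup>+\<^sup>n\<^sup>-\<^sup>1\<close> gives \<open>D g = 0\<close>, so \<open>g\<close> depends on \<open>t\<close> only and \<open>\<partial>G/\<partial>x\<close> is a symmetry of
  lower order. By induction on the order it is killed by some \<open>L = \<Prod>\<^sub>i (\<partial>/\<partial>t - \<lambda>\<^sub>i)\<close>, hence \<open>L G\<close> is an
  \<open>x\<close>-independent symmetry. For \<open>x\<close>-independent \<open>G\<close> one even has \<open>\<partial>g/\<partial>t = 0\<close>: then \<open>\<partial>(L G)/\<partial>t\<close> has lower order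
  as well, and \<open>G\<close> itself is killed by a product of operators \<open>\<partial>/\<partial>t - \<lambda>\<close>.

  That \<open>\<partial>g/\<partial>t = 0\<close> follows from a statement about differential operators over the \<open>x\<close>-independent
  functions, in which no nonzero constant is a \<open>D\<close>-derivative: if \<open>A\<close> is monic and
  \<open>[A, Q] = r D\<^sup>e + \<dots>\<close> with \<open>D r = 0\<close>, then \<open>r = 0\<close>. Let \<open>q\<close> be the leading coefficient of \<open>Q\<close>, of
  order \<open>m\<close>. If \<open>e = m + n - 1\<close> then \<open>r = n D q\<close>, so \<open>r = 0\<close>. Otherwise \<open>D q = 0\<close>, and replacing \<open>Q\<close> by
  \<open>Q\<^sup>n - q\<^sup>n A\<^sup>m\<close>, and then by \<open>r Q\<close>, decreases \<open>m + n - e\<close>. This avoids fractional powers of \<open>F\<^sub>*\<close>.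
\<close>

section \<open>Commutators of differential operators\<close>

lemma smult_sum_right: "smult a (sum h S) = (\<Sum>i\<in>S. smult a (h i))"
  by (induction S rule: infinite_finite_induct) (simp_all add: smult_add_right)

text \<open>The derivation laws are required only on \<open>K\<close>, because the total derivative
  is known to be additive and Leibniz only on smooth functions, while the ambient type is the ring
  of all functions. \<open>shift\<close>, \<open>act\<close> and \<open>commutator\<close> depend on
  \<open>D\<close> alone and only \<open>symbols\<close> depends on \<open>K\<close>, so two
  subrings with the same \<open>D\<close> share their operator calculus.\<close>

locale differential_subring =
  fixes K :: "'a::comm_ring_1 set" and D :: "'a \<Rightarrow> 'a"
  assumes K_1: "1 \<in> K"
    and K_add: "a \<in> K \<Longrightarrow> b \<in> K \<Longrightarrow> a + b \<in> K"
    and K_uminus: "a \<in> K \<Longrightarrow> - a \<in> K"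
    and K_mult: "a \<in> K \<Longrightarrow> b \<in> K \<Longrightarrow> a * b \<in> K"
    and K_D: "a \<in> K \<Longrightarrow> D a \<in> K"
    and D_add: "a \<in> K \<Longrightarrow> b \<in> K \<Longrightarrow> D (a + b) = D a + D b"
    and D_mult: "a \<in> K \<Longrightarrow> b \<in> K \<Longrightarrow> D (a * b) = D a * b + a * D b"
begin

lemma K_0: "0 \<in> K"
  using K_add[OF K_1 K_uminus[OF K_1]] by simp

lemma K_diff: "a \<in> K \<Longrightarrow> b \<in> K \<Longrightarrow> a - b \<in> K"
  using K_add[of a "- b"] K_uminus[of b] by simp

lemma K_sum: "(\<And>i. i \<in> S \<Longrightarrow> h i \<in> K) \<Longrightarrow> sum h S \<in> K"
  by (induction S rule: infinite_finite_induct) (auto intro: K_0 K_add)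

lemma K_power: "a \<in> K \<Longrightarrow> a ^ k \<in> K"
  by (induction k) (auto intro: K_1 K_mult)

lemma K_of_nat: "of_nat k \<in> K"
  by (induction k) (auto intro: K_1 K_add K_0)

lemma D_0: "D 0 = 0"
  using D_add[OF K_0 K_0] by simp

lemma D_1: "D 1 = 0"
  using D_mult[OF K_1 K_1] by simp

lemma D_of_nat: "D (of_nat k) = 0"
  by (induction k) (simp_all add: D_0 D_1 D_add K_1 K_of_nat)

lemma D_power_eq_0: "a \<in> K \<Longrightarrow> D a = 0 \<Longrightarrow> D (a ^ k) = 0"
  by (induction k) (simp_all add: D_1 D_mult K_power)

text \<open>
  The operator \<open>\<Sum> a\<^sub>i D\<^sup>i\<close> is encoded by its symbol \<open>\<Sum> a\<^sub>i \<xi>\<^sup>i\<close>. On symbols, \<open>D \<circ> _\<close> becomes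
  \<open>shift\<close> and the composition of operators becomes \<open>act\<close>.
\<close>

definition symbols :: "'a poly set" where
  "symbols = {Y. \<forall>i. coeff Y i \<in> K}"

definition shift :: "'a poly \<Rightarrow> 'a poly" where
  "shift Y = map_poly D Y + pCons 0 Y"

definition act :: "'a poly \<Rightarrow> 'a poly \<Rightarrow> 'a poly" where
  "act P Y = (\<Sum>i\<le>degree P. smult (coeff P i) ((shift ^^ i) Y))"

definition commutator :: "'a poly \<Rightarrow> 'a poly \<Rightarrow> 'a poly" where
  "commutator P Q = act P Q - act Q P"

section \<open>Linearity and associativity of operator composition\<close>

lemma coeff_shift: "coeff (shift Y) i = D (coeff Y i) + coeff (pCons 0 Y) i"
  by (simp add: shift_def coeff_map_poly D_0)

lemma coeff_symbols: "Y \<in> symbols \<Longrightarrow> coeff Y i \<in> K"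
  by (simp add: symbols_def)

lemma pCons_symbols: "Y \<in> symbols \<Longrightarrow> coeff (pCons 0 Y) i \<in> K"
  by (cases i) (auto simp: symbols_def K_0)

lemma shift_symbols: "Y \<in> symbols \<Longrightarrow> shift Y \<in> symbols"
  unfolding symbols_def mem_Collect_eq coeff_shift
  by (auto intro!: K_add K_D pCons_symbols simp: symbols_def)

lemma shift_pow_symbols: "Y \<in> symbols \<Longrightarrow> (shift ^^ i) Y \<in> symbols"
  by (induction i) (auto intro: shift_symbols)

lemma add_symbols: "X \<in> symbols \<Longrightarrow> Y \<in> symbols \<Longrightarrow> X + Y \<in> symbols"
  by (auto simp: symbols_def intro: K_add)

lemma diff_symbols: "X \<in> symbols \<Longrightarrow> Y \<in> symbols \<Longrightarrow> X - Y \<in> symbols"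
  by (auto simp: symbols_def intro: K_diff)

lemma smult_symbols: "a \<in> K \<Longrightarrow> Y \<in> symbols \<Longrightarrow> smult a Y \<in> symbols"
  by (auto simp: symbols_def intro: K_mult)

lemma sum_symbols: "(\<And>i. i \<in> S \<Longrightarrow> h i \<in> symbols) \<Longrightarrow> sum h S \<in> symbols"
  by (auto simp: symbols_def coeff_sum intro!: K_sum)

lemma one_symbols: "1 \<in> symbols"
  by (auto simp: symbols_def coeff_1 K_0 K_1)

lemma act_symbols: "P \<in> symbols \<Longrightarrow> Y \<in> symbols \<Longrightarrow> act P Y \<in> symbols"
  unfolding act_def
  by (intro sum_symbols smult_symbols shift_pow_symbols) (auto simp: symbols_def)

lemma shift_0: "shift 0 = 0"
  by (simp add: shift_def)

lemma shift_add: "X \<in> symbols \<Longrightarrow> Y \<in> symbols \<Longrightarrow> shift (X + Y) = shift X + shift Y"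
  by (rule poly_eqI) (auto simp: coeff_shift D_add coeff_symbols coeff_pCons split: nat.split)

lemma shift_smult:
  "a \<in> K \<Longrightarrow> Y \<in> symbols \<Longrightarrow> shift (smult a Y) = smult (D a) Y + smult a (shift Y)"
  by (rule poly_eqI)
    (auto simp: coeff_shift D_mult coeff_symbols coeff_pCons algebra_simps split: nat.split)

lemma shift_sum:
  "(\<And>i. i \<in> S \<Longrightarrow> h i \<in> symbols) \<Longrightarrow> shift (sum h S) = (\<Sum>i\<in>S. shift (h i))"
  by (induction S rule: infinite_finite_induct) (auto simp: shift_0 shift_add sum_symbols)

lemma shift_pow_add:
  "X \<in> symbols \<Longrightarrow> Y \<in> symbols \<Longrightarrow> (shift ^^ i) (X + Y) = (shift ^^ i) X + (shift ^^ i) Y"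
  by (induction i) (auto simp: shift_add shift_pow_symbols)

lemma shift_pow_smult_const:
  "a \<in> K \<Longrightarrow> D a = 0 \<Longrightarrow> Y \<in> symbols \<Longrightarrow> (shift ^^ i) (smult a Y) = smult a ((shift ^^ i) Y)"
  by (induction i) (auto simp: shift_smult shift_pow_symbols)

text \<open>Padding with zero coefficients lets operators of different degrees share one summation
  range.\<close>

lemma act_eq:
  assumes "degree P \<le> N"
  shows "act P Y = (\<Sum>i\<le>N. smult (coeff P i) ((shift ^^ i) Y))"
  unfolding act_def using assms
  by (intro sum.mono_neutral_left) (auto simp: coeff_eq_0)

lemma act_add_left: "act (P + Q) Y = act P Y + act Q Y"
proof -
  define N where "N = max (degree P) (degree Q)"
  have "degree (P + Q) \<le> N" "degree P \<le> N" "degree Q \<le> N"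
    by (auto simp: N_def degree_add_le)
  then show ?thesis
    by (simp add: act_eq smult_add_left sum.distrib)
qed

lemma act_smult_left: "act (smult a P) Y = smult a (act P Y)"
proof -
  have "degree (smult a P) \<le> degree P"
    by (simp add: degree_smult_le)
  from act_eq[OF this] show ?thesis
    by (simp add: act_def smult_sum_right)
qed

lemma act_0_left: "act 0 Y = 0"
  by (simp add: act_def)

lemma act_sum_left: "act (sum h S) Y = (\<Sum>i\<in>S. act (h i) Y)"
  by (induction S rule: infinite_finite_induct) (auto simp: act_0_left act_add_left)

lemma act_diff_left: "act (P - Q) Y = act P Y - act Q Y"
  using act_add_left[of "P - Q" Q Y] by simp

lemma act_add_right:
  "X \<in> symbols \<Longrightarrow> Y \<in> symbols \<Longrightarrow> act P (X + Y) = act P X + act P Y"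
  by (simp add: act_def shift_pow_add smult_add_right sum.distrib)

lemma act_diff_right:
  "X \<in> symbols \<Longrightarrow> Y \<in> symbols \<Longrightarrow> act P (X - Y) = act P X - act P Y"
  using act_add_right[of "X - Y" Y P] by (simp add: diff_symbols)

lemma act_smult_const_right:
  "a \<in> K \<Longrightarrow> D a = 0 \<Longrightarrow> Y \<in> symbols \<Longrightarrow> act P (smult a Y) = smult a (act P Y)"
  by (simp add: act_def shift_pow_smult_const smult_sum_right mult.commute)

text \<open>This is associativity for the single left factor \<open>D\<close>. Left-linearity of
  \<open>act\<close> and iteration then yield \<open>act_assoc\<close>.\<close>

lemma act_shift:
  assumes P: "P \<in> symbols" and Y: "Y \<in> symbols"
  shows "act (shift P) Y = shift (act P Y)"
proof -
  define N where "N = degree P"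
  have N: "degree P \<le> Suc N" "degree (shift P) \<le> Suc N"
    by (auto simp: N_def intro!: degree_le simp: coeff_shift coeff_eq_0 coeff_pCons D_0
        split: nat.split)
  have "act (shift P) Y = (\<Sum>i\<le>Suc N. smult (D (coeff P i)) ((shift ^^ i) Y))
      + (\<Sum>i\<le>Suc N. smult (coeff (pCons 0 P) i) ((shift ^^ i) Y))"
    by (simp add: act_eq[OF N(2)] coeff_shift smult_add_left sum.distrib del: sum.atMost_Suc)
  also have "(\<Sum>i\<le>Suc N. smult (coeff (pCons 0 P) i) ((shift ^^ i) Y))
      = (\<Sum>i\<le>N. smult (coeff P i) ((shift ^^ Suc i) Y))"
    by (simp add: sum.atMost_Suc_shift del: sum.atMost_Suc)
  \<comment> \<open>The added term is zero because \<open>coeff P (Suc N)\<close> lies above the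
    degree; with equal ranges the two sums merge termwise by the product rule.\<close>
  also have "\<dots> = (\<Sum>i\<le>Suc N. smult (coeff P i) ((shift ^^ Suc i) Y))"
    by (simp add: N_def coeff_eq_0)
  also have "(\<Sum>i\<le>Suc N. smult (D (coeff P i)) ((shift ^^ i) Y)) + \<dots>
      = (\<Sum>i\<le>Suc N. shift (smult (coeff P i) ((shift ^^ i) Y)))"
    unfolding sum.distrib[symmetric]
    by (rule sum.cong) (simp_all add: shift_smult coeff_symbols P Y shift_pow_symbols)
  also have "\<dots> = shift (act P Y)"
    unfolding act_eq[OF N(1)]
    by (rule shift_sum[symmetric]) (intro smult_symbols shift_pow_symbols coeff_symbols P Y)
  finally show ?thesis .
qed

lemma act_shift_pow:
  "P \<in> symbols \<Longrightarrow> Y \<in> symbols \<Longrightarrow> act ((shift ^^ i) P) Y = (shift ^^ i) (act P Y)"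
  by (induction i) (auto simp: act_shift shift_pow_symbols)

lemma act_assoc:
  "Q \<in> symbols \<Longrightarrow> Y \<in> symbols \<Longrightarrow> act (act P Q) Y = act P (act Q Y)"
  by (simp add: act_def[of P] act_sum_left act_smult_left act_shift_pow)

text \<open>The identity operator has symbol \<open>1\<close>, so the symbol of \<open>D\<close>
  iterated \<open>i\<close> times is the plain monomial; this makes \<open>1\<close> a right unit
  for \<open>act\<close>.\<close>

lemma shift_pow_1: "(shift ^^ i) 1 = monom 1 i"
proof (induction i)
  case (Suc i)
  have "shift (monom 1 i) = monom 1 (Suc i)"
    by (rule poly_eqI) (auto simp: coeff_shift D_0 D_1 coeff_pCons split: nat.split)
  then show ?case by (simp add: Suc)
qed (simp add: monom_0 one_pCons)

lemma act_1_right: "act P 1 = P"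
  by (simp add: act_def shift_pow_1 smult_monom poly_as_sum_of_monoms)

lemma act_1_left: "act 1 Y = Y"
  by (simp add: act_def)

lemma act_const_right:
  assumes "a \<in> K" "D a = 0"
  shows "act P [:a:] = smult a P"
proof -
  have "[:a:] = smult a 1" by simp
  then show ?thesis
    using act_smult_const_right[OF assms one_symbols] by (simp add: act_1_right)
qed

lemma act_const_left: "act [:a:] Y = smult a Y"
  by (simp add: act_def)

section \<open>Leading and subleading coefficients of compositions\<close>

lemma degree_shift_le: "degree Y \<le> d \<Longrightarrow> degree (shift Y) \<le> Suc d"
  by (rule degree_le) (auto simp: coeff_shift coeff_eq_0 coeff_pCons D_0 split: nat.split)

lemma degree_shift_pow_le: "degree Y \<le> d \<Longrightarrow> degree ((shift ^^ i) Y) \<le> i + d"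
  by (induction i) (auto intro: degree_shift_le)

lemma coeff_shift_pow_top: "degree Y \<le> d \<Longrightarrow> coeff ((shift ^^ i) Y) (i + d) = coeff Y d"
proof (induction i)
  case (Suc i)
  then show ?case
    using degree_shift_pow_le[OF Suc.prems, of i]
    by (simp add: coeff_shift coeff_eq_0 D_0)
qed auto

text \<open>The factor \<open>\<xi>\<close> in \<open>pCons 0\<close> shifts indices so that the subleading coefficient is never at \<open>- 1\<close>.\<close>

lemma coeff_shift_pow_sub:
  assumes "degree Y \<le> d"
  shows "coeff (pCons 0 ((shift ^^ i) Y)) (i + d) = coeff (pCons 0 Y) d + of_nat i * D (coeff Y d)"
proof (induction i)
  case (Suc i)
  then show ?case
    using coeff_shift_pow_top[OF assms, of i] by (simp add: coeff_shift algebra_simps)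
qed auto

lemma degree_act_le: "degree P \<le> m \<Longrightarrow> degree Y \<le> d \<Longrightarrow> degree (act P Y) \<le> m + d"
  unfolding act_def
  by (rule degree_sum_le) (auto intro!: order.trans[OF degree_smult_le] order.trans[OF degree_shift_pow_le])

lemma coeff_act_top:
  assumes "degree P \<le> m" "degree Y \<le> d"
  shows "coeff (act P Y) (m + d) = coeff P m * coeff Y d"
proof -
  have "coeff (act P Y) (m + d) = (\<Sum>i\<le>m. coeff P i * coeff ((shift ^^ i) Y) (m + d))"
    by (simp add: act_eq[OF assms(1)] coeff_sum)
  also have "\<dots> = (\<Sum>i\<le>m. if i = m then coeff P m * coeff Y d else 0)"
  proof (intro sum.cong refl)
    fix i assume "i \<in> {..m}"
    then show "coeff P i * coeff ((shift ^^ i) Y) (m + d) = (if i = m then coeff P m * coeff Y d else 0)"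
      using degree_shift_pow_le[OF assms(2), of i]
      by (auto simp: coeff_shift_pow_top assms coeff_eq_0)
  qed
  finally show ?thesis by simp
qed

lemma coeff_act_sub:
  assumes P: "degree P \<le> m" and Y: "degree Y \<le> d"
  shows "coeff (pCons 0 (act P Y)) (m + d)
    = coeff P m * (coeff (pCons 0 Y) d + of_nat m * D (coeff Y d)) + coeff (pCons 0 P) m * coeff Y d"
proof (cases m)
  case 0
  with P obtain a where a: "P = [:a:]" by (metis degree_eq_zeroE le_zero_eq)
  show ?thesis
    by (cases d) (simp_all add: a 0 act_const_left)
next
  case (Suc l)
  \<comment> \<open>Only the top monomial of \<open>P\<close> can differentiate the leading
    coefficient of \<open>Y\<close> at this index. The remainder \<open>R\<close> has degree at most
    m - 1 and contributes merely the product of top coefficients; m = 0 was treated apart because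
    there \<open>R\<close> would have no such bound.\<close>
  define R where "R = P - monom (coeff P m) m"
  have R: "degree R \<le> l"
  proof (rule degree_le, intro allI impI)
    fix i assume "l < i"
    then show "coeff R i = 0"
      using P Suc by (cases "i = m") (auto simp: R_def coeff_eq_0)
  qed
  have cR: "coeff R l = coeff (pCons 0 P) m"
    by (simp add: R_def Suc)
  have "act (monom (coeff P m) m) Y = smult (coeff P m) ((shift ^^ m) Y)"
    unfolding act_eq[OF degree_monom_le]
    by (simp add: if_distrib[of "\<lambda>c. smult c _"] cong: if_cong)
  then have "act P Y = act R Y + smult (coeff P m) ((shift ^^ m) Y)"
    using act_add_left[of R "monom (coeff P m) m" Y] by (simp add: R_def)
  then have "coeff (pCons 0 (act P Y)) (m + d)
      = coeff (act R Y) (l + d) + coeff P m * coeff (pCons 0 ((shift ^^ m) Y)) (m + d)"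
    by (simp add: Suc)
  then show ?thesis
    using coeff_shift_pow_sub[OF Y, of m] coeff_act_top[OF R Y] cR by simp
qed

section \<open>Commutators with a fixed operator\<close>

lemma commutator_symbols:
  "P \<in> symbols \<Longrightarrow> Q \<in> symbols \<Longrightarrow> commutator P Q \<in> symbols"
  by (simp add: commutator_def diff_symbols act_symbols)

lemma commutator_diff_right:
  "X \<in> symbols \<Longrightarrow> Y \<in> symbols \<Longrightarrow> commutator P (X - Y) = commutator P X - commutator P Y"
  by (simp add: commutator_def act_diff_right act_diff_left)

lemma commutator_smult_const:
  "a \<in> K \<Longrightarrow> D a = 0 \<Longrightarrow> Y \<in> symbols \<Longrightarrow> commutator P (smult a Y) = smult a (commutator P Y)"
  by (simp add: commutator_def act_smult_const_right act_smult_left smult_diff_right)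

text \<open>The mixed term \<open>P\<close> between \<open>Q\<close> and \<open>R\<close> cancels by
  associativity, so commuting with \<open>P\<close> is a derivation of composition.\<close>

lemma commutator_act:
  "P \<in> symbols \<Longrightarrow> Q \<in> symbols \<Longrightarrow> R \<in> symbols \<Longrightarrow>
    commutator P (act Q R) = act (commutator P Q) R + act Q (commutator P R)"
  by (simp add: commutator_def act_diff_left act_diff_right act_assoc act_symbols)

text \<open>The coefficient ring is commutative, so the top coefficients cancel. One index lower the
  undifferentiated products cancel as well, and D 1 = 0 leaves only the term in which
  \<open>A\<close> differentiates the leading coefficient of \<open>Q\<close>. Because of
  \<open>pCons 0\<close>, the index n + m stands for the coefficient at n + m - 1.\<close>

lemma coeff_commutator_monic:
  assumes A: "degree A \<le> n" "coeff A n = 1" and Q: "degree Q \<le> m"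
  shows "coeff (pCons 0 (commutator A Q)) (n + m) = of_nat n * D (coeff Q m)"
    and "n + m \<le> i \<Longrightarrow> coeff (commutator A Q) i = 0"
proof -
  have p: "pCons 0 (commutator A Q) = pCons 0 (act A Q) - pCons 0 (act Q A)"
    by (simp add: commutator_def)
  show "coeff (pCons 0 (commutator A Q)) (n + m) = of_nat n * D (coeff Q m)"
    unfolding p coeff_diff
    using coeff_act_sub[OF A(1) Q] coeff_act_sub[OF Q A(1)] A(2)
    by (simp add: D_1 algebra_simps)
  assume "n + m \<le> i"
  then consider "i = n + m" | "n + m < i" by linarith
  then show "coeff (commutator A Q) i = 0"
  proof cases
    case 1
    then show ?thesis
      using coeff_act_top[OF A(1) Q] coeff_act_top[OF Q A(1)] A(2)
      by (simp add: commutator_def add.commute)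
  next
    case 2
    then have "coeff (act A Q) i = 0" "coeff (act Q A) i = 0"
      using degree_act_le[OF A(1) Q] degree_act_le[OF Q A(1)] by (auto intro!: coeff_eq_0)
    then show ?thesis by (simp add: commutator_def)
  qed
qed

primrec op_power :: "'a poly \<Rightarrow> nat \<Rightarrow> 'a poly" where
  "op_power P 0 = 1"
| "op_power P (Suc j) = act P (op_power P j)"

lemma op_power_symbols: "P \<in> symbols \<Longrightarrow> op_power P j \<in> symbols"
  by (induction j) (auto intro: one_symbols act_symbols)

lemma degree_op_power_le: "degree P \<le> m \<Longrightarrow> degree (op_power P j) \<le> j * m"
proof (induction j)
  case (Suc j)
  then show ?case using degree_act_le[of P m "op_power P j" "j * m"] by simp
qed simp

lemma coeff_op_power_top: "degree P \<le> m \<Longrightarrow> coeff (op_power P j) (j * m) = coeff P m ^ j"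
proof (induction j)
  case (Suc j)
  then show ?case
    using coeff_act_top[of P m "op_power P j" "j * m"] degree_op_power_le[of P m j] by simp
qed simp

lemma commutator_op_power_self:
  assumes "P \<in> symbols"
  shows "commutator P (op_power P j) = 0"
proof (induction j)
  case 0
  then show ?case by (simp add: commutator_def act_1_left act_1_right)
next
  case (Suc j)
  have "act P 0 = 0"
    using act_diff_right[OF one_symbols one_symbols, of P] by simp
  with Suc assms show ?case
    by (simp add: commutator_act op_power_symbols)
      (simp add: commutator_def act_0_left)
qed

text \<open>By the Leibniz rule each of the j + 1 factors \<open>Q\<close> is replaced once by the
  commutator; top coefficients commute, so all these terms agree at the top. Both \<open>m\<close>
  and \<open>e\<close> are mere degree bounds, and the top coefficients may vanish.\<close>

lemma commutator_op_power:
  assumes A: "A \<in> symbols" and Q: "Q \<in> symbols" "degree Q \<le> m"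
    and e: "degree (commutator A Q) \<le> e"
  shows "degree (commutator A (op_power Q (Suc j))) \<le> j * m + e \<and>
    coeff (commutator A (op_power Q (Suc j))) (j * m + e)
      = of_nat (Suc j) * coeff Q m ^ j * coeff (commutator A Q) e"
proof (induction j)
  case 0
  then show ?case using e by (simp add: act_1_right)
next
  case (Suc j)
  define R where "R = op_power Q (Suc j)"
  have R: "R \<in> symbols" "degree R \<le> Suc j * m" "coeff R (Suc j * m) = coeff Q m ^ Suc j"
    unfolding R_def by (rule op_power_symbols degree_op_power_le coeff_op_power_top Q)+
  have eq: "commutator A (op_power Q (Suc (Suc j))) = act (commutator A Q) R + act Q (commutator A R)"
    using commutator_act[OF A Q(1) R(1)] by (simp add: R_def)
  note IH = Suc[folded R_def]
  \<comment> \<open>The same index is split in two ways, to match the degree bounds of the two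
    products in the Leibniz rule.\<close>
  have i: "Suc j * m + e = e + Suc j * m" "Suc j * m + e = m + (j * m + e)"
    by simp_all
  have "degree (act (commutator A Q) R) \<le> Suc j * m + e"
    "degree (act Q (commutator A R)) \<le> Suc j * m + e"
    using degree_act_le[OF e R(2)] degree_act_le[OF Q(2) IH[THEN conjunct1]]
    unfolding i(1)[symmetric] i(2)[symmetric] by auto
  moreover have "coeff (act (commutator A Q) R) (Suc j * m + e)
      = coeff (commutator A Q) e * coeff Q m ^ Suc j"
    unfolding i(1) coeff_act_top[OF e R(2)] R(3) ..
  moreover have "coeff (act Q (commutator A R)) (Suc j * m + e)
      = coeff Q m * (of_nat (Suc j) * coeff Q m ^ j * coeff (commutator A Q) e)"
    unfolding i(2) coeff_act_top[OF Q(2) IH[THEN conjunct1]] IH[THEN conjunct2] ..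
  ultimately show ?case
    unfolding eq by (auto intro!: degree_add_le simp: algebra_simps)
qed

text \<open>A ring of functions has zero divisors, so no division by leading coefficients is
  possible. Cancelling integers (\<open>torsion_free\<close>) and the absence of nilpotents
  (\<open>reduced\<close>) replace it.\<close>

lemma commutator_monic_top_coeff_eq_0:
  assumes torsion_free: "\<And>k (x::'a). k > 0 \<Longrightarrow> of_nat k * x = 0 \<Longrightarrow> x = 0"
    and reduced: "\<And>k (x::'a). x ^ k = 0 \<Longrightarrow> x = 0"
    and no_antiderivative: "\<And>a. a \<in> K \<Longrightarrow> D (D a) = 0 \<Longrightarrow> D a = 0"
    and n: "n > 0" and A: "A \<in> symbols" "degree A \<le> n" "coeff A n = 1"
    and Q: "Q \<in> symbols"
    and e: "degree (commutator A Q) \<le> e" "D (coeff (commutator A Q) e) = 0"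
  shows "coeff (commutator A Q) e = 0"
proof -
  \<comment> \<open>Strong induction on a bound \<open>w\<close> for m + n - e, with
    \<open>Q\<close> and both degree bounds varying; \<open>A\<close> and \<open>n\<close> stay
    fixed.\<close>
  have main: "coeff (commutator A Q) e = 0"
    if "degree Q \<le> m" "m + n - e \<le> w" "Q \<in> symbols" "degree (commutator A Q) \<le> e"
      "D (coeff (commutator A Q) e) = 0" for w m e Q
    using that
  proof (induction w arbitrary: m e Q rule: less_induct)
    case (less w)
    note Q = less.prems(1,3) and e = less.prems(4,5)
    define q r where "q = coeff Q m" and "r = coeff (commutator A Q) e"
    have qK: "q \<in> K" and rK: "r \<in> K"
      unfolding q_def r_def by (intro coeff_symbols commutator_symbols A Q)+
    note sub = coeff_commutator_monic[OF A(2,3) Q(1)]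
    consider "n + m \<le> e" | "n + m = Suc e" | "Suc e < n + m" by linarith
    then show ?case
    proof cases
      case 1
      then show ?thesis using sub(2) by blast
    next
      case 2
      then have "r = of_nat n * D q"
        using sub(1) by (simp add: r_def q_def)
      \<comment> \<open>Here \<open>r\<close> is itself a derivative, and D r = 0 says that its
        antiderivative is killed by applying \<open>D\<close> twice;
        \<open>no_antiderivative\<close> then gives r = 0.\<close>
      then have "r = D (of_nat n * q)"
        by (simp add: D_mult K_of_nat qK D_of_nat)
      then show ?thesis
        using no_antiderivative[of "of_nat n * q"] e(2) qK
        by (simp add: r_def[symmetric] K_mult K_of_nat)
    next
      case 3
      \<comment> \<open>The index i = n + m - 1 exceeds the degree of the commutator, so the
        coefficient n D q found there is zero.\<close>
      then obtain i where i: "n + m = Suc i" "e < i"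
        by (metis Suc_less_eq less_imp_Suc_add add_Suc_right)
      then have "of_nat n * D q = 0"
        using sub(1) e(1) by (simp add: q_def coeff_eq_0)
      then have Dq: "D q = 0" using torsion_free n by blast
      show ?thesis
      proof (cases m)
        case 0
        with Q(1) have "Q = [:q:]"
          unfolding q_def by (metis degree_eq_zeroE le_zero_eq coeff_pCons_0)
        then have "commutator A Q = 0"
          by (simp add: commutator_def act_const_right act_const_left qK Dq)
        then show ?thesis by simp
      next
        case (Suc m')
        obtain n' where n': "n = Suc n'" using n by (cases n) auto
        have w: "m + n - e > 0" using i by simp
        \<comment> \<open>Both terms have top coefficient q^n at index nm, so the order drops to nm
          - 1. As q^n is constant and \<open>A\<close> commutes with its powers, the commutator with
          \<open>A\<close> is that of the n-th power of \<open>Q\<close>, with top coefficient n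
          q^(n-1) r at (n-1)m + e. The measure falls to m + n - 1 - e.\<close>
        define Q' where "Q' = op_power Q n - smult (q ^ n) (op_power A m)"
        have q_n: "q ^ n \<in> K" "D (q ^ n) = 0"
          using qK Dq by (auto intro: K_power D_power_eq_0)
        have Q'_symbols: "Q' \<in> symbols"
          unfolding Q'_def
          by (intro diff_symbols smult_symbols op_power_symbols Q A q_n)
        have Q'_degree: "degree Q' \<le> n * m - 1"
        proof (rule degree_le, intro allI impI)
          fix j assume j: "n * m - 1 < j"
          have d: "degree (op_power Q n) \<le> n * m" "degree (op_power A m) \<le> n * m"
            using degree_op_power_le[OF Q(1), of n] degree_op_power_le[OF A(2), of m]
            by (auto simp: mult.commute)
          show "coeff Q' j = 0"
          proof (cases "j = n * m")
            case True
            then show ?thesis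
              using coeff_op_power_top[OF Q(1), of n] coeff_op_power_top[OF A(2), of m] A(3)
              by (simp add: Q'_def q_def mult.commute)
          next
            case False
            with j have "n * m < j" by linarith
            then show ?thesis
              using d by (simp add: Q'_def coeff_eq_0)
          qed
        qed
        have c: "commutator A Q' = commutator A (op_power Q (Suc n'))"
          unfolding Q'_def
          using q_n by (simp add: commutator_diff_right commutator_smult_const op_power_symbols
              smult_symbols Q A commutator_op_power_self n' del: op_power.simps power_Suc)
        have c1: "degree (commutator A Q') \<le> n' * m + e"
          and c2: "coeff (commutator A Q') (n' * m + e) = of_nat n * q ^ n' * r"
          using commutator_op_power[OF A(1) Q(2,1) e(1), of n']
          by (simp_all add: c q_def r_def n')
        have c3: "D (of_nat n * q ^ n' * r) = 0"
          using qK Dq rK e(2) by (simp add: D_mult K_mult K_power K_of_nat D_of_nat D_power_eq_0 r_def[symmetric])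
        have "coeff (commutator A Q') (n' * m + e) = 0"
        proof (rule less.IH[OF _ Q'_degree order.refl Q'_symbols c1])
          show "n * m - 1 + n - (n' * m + e) < w"
            using less.prems(2) w Suc n' by simp
        qed (simp add: c2 c3)
        then have "of_nat n * (q ^ n' * r) = 0"
          by (simp add: c2 mult.assoc)
        then have "q ^ n' * r = 0"
          using torsion_free n by blast
        \<comment> \<open>Extra factors q and r turn q^(n-1) r = 0 into a vanishing n-th power, to
          which \<open>reduced\<close> applies.\<close>
        then have "(q * r) ^ Suc n' = 0"
          by (simp add: power_mult_distrib algebra_simps)
            (metis mult.assoc mult.commute mult_zero_left)
        then have qr: "r * q = 0"
          using reduced mult.commute by metis
        \<comment> \<open>Multiplying by the constant \<open>r\<close> kills the coefficient of
          \<open>Q\<close> at m, since rq = 0, and leaves a commutator with top coefficient r^2. The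
          induction hypothesis at order m - 1 then makes r^2 vanish.\<close>
        have r2: "commutator A (smult r Q) = smult r (commutator A Q)"
          using commutator_smult_const[OF rK] e(2) Q(2) by (simp add: r_def[symmetric])
        have "coeff (commutator A (smult r Q)) e = 0"
        proof (rule less.IH[OF _ _ order.refl])
          show "degree (smult r Q) \<le> m'"
          proof (rule degree_le, intro allI impI)
            fix j assume "m' < j"
            then show "coeff (smult r Q) j = 0"
              using Q(1) qr Suc by (cases "j = m") (auto simp: q_def coeff_eq_0)
          qed
          show "m' + n - e < w"
            using less.prems(2) w Suc by simp
          show "degree (commutator A (smult r Q)) \<le> e"
            unfolding r2 using e(1) degree_smult_le order.trans by blast
          show "D (coeff (commutator A (smult r Q)) e) = 0"
            using e(2) rK by (simp add: r2 D_mult r_def[symmetric])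
        qed (auto intro: smult_symbols rK Q)
        then have "r ^ 2 = 0"
          by (simp add: r2 power2_eq_square r_def[symmetric])
        then show ?thesis using reduced by (auto simp: r_def)
      qed
    qed
  qed
  show ?thesis
    by (rule main[OF order.refl order.refl Q e])
qed

end

section \<open>Smooth functions on an open set of jets\<close>

text \<open>The mean value theorem is applied first to the increment in y as a function of x, then
  to the derivative in y. The second difference is symmetric in the two variables, so using this in
  both orders compares the mixed partial derivatives.\<close>

lemma second_difference_mean_value:
  fixes \<phi> \<phi>1 \<phi>12 :: "real \<Rightarrow> real \<Rightarrow> real"
  assumes "h > 0"
    and d1: "\<And>x y. a \<le> x \<Longrightarrow> x \<le> a + h \<Longrightarrow> b \<le> y \<Longrightarrow> y \<le> b + h \<Longrightarrow>
      ((\<lambda>x. \<phi> x y) has_real_derivative \<phi>1 x y) (at x)"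
    and d2: "\<And>x y. a \<le> x \<Longrightarrow> x \<le> a + h \<Longrightarrow> b \<le> y \<Longrightarrow> y \<le> b + h \<Longrightarrow>
      ((\<lambda>y. \<phi>1 x y) has_real_derivative \<phi>12 x y) (at y)"
  obtains x y where "a < x" "x < a + h" "b < y" "y < b + h"
    "\<phi> (a + h) (b + h) - \<phi> (a + h) b - \<phi> a (b + h) + \<phi> a b = h * (h * \<phi>12 x y)"
proof -
  have "\<exists>x. a < x \<and> x < a + h \<and> (\<phi> (a + h) (b + h) - \<phi> (a + h) b) - (\<phi> a (b + h) - \<phi> a b)
      = (a + h - a) * (\<phi>1 x (b + h) - \<phi>1 x b)"
    by (rule MVT2) (use \<open>h > 0\<close> in \<open>auto intro!: DERIV_diff d1\<close>)
  then obtain x where x: "a < x" "x < a + h"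
    and x_eq: "(\<phi> (a + h) (b + h) - \<phi> (a + h) b) - (\<phi> a (b + h) - \<phi> a b)
      = h * (\<phi>1 x (b + h) - \<phi>1 x b)" by auto
  have "\<exists>y. b < y \<and> y < b + h \<and> \<phi>1 x (b + h) - \<phi>1 x b = (b + h - b) * \<phi>12 x y"
    by (rule MVT2) (use \<open>h > 0\<close> x in \<open>auto intro!: d2\<close>)
  then obtain y where "b < y" "y < b + h" "\<phi>1 x (b + h) - \<phi>1 x b = h * \<phi>12 x y" by auto
  with x x_eq show ?thesis using that[of x y] by simp
qed

locale jet_open =
  fixes M :: "jet_point set"
  assumes open_M: "open M"
begin

section \<open>Partial derivatives on an open set of jets\<close>

lemma continuous_on_upd: "continuous_on UNIV (\<lambda>s. p(v := s) :: jet_point)"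
proof (rule continuous_on_coordinatewise_then_product)
  show "continuous_on UNIV (\<lambda>s. (p(v := s)) i)" for i
    by (cases "i = v") auto
qed

lemma continuous_on_upd2:
  "continuous_on UNIV (\<lambda>z. p(v := fst z, w := snd z) :: jet_point)"
proof (rule continuous_on_coordinatewise_then_product)
  show "continuous_on UNIV (\<lambda>z. (p(v := fst z, w := snd z)) i)" for i
    by (cases "i = w"; cases "i = v") (auto intro!: continuous_intros)
qed

text \<open>Openness keeps small changes of one coordinate inside \<open>M\<close>, so partial
  derivatives at points of \<open>M\<close> see only values on \<open>M\<close>.\<close>

lemma eventually_upd: "p \<in> M \<Longrightarrow> eventually (\<lambda>s. p(v := s) \<in> M) (nhds (p v))"
  using eventually_nhds_in_open[OF open_vimage[OF open_M continuous_on_upd[of p v]], of "p v"]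
  by simp

lemma pd_cong:
  assumes "\<And>p. p \<in> M \<Longrightarrow> g p = h p" "p \<in> M"
  shows "pd v g p = pd v h p"
  unfolding pd_def
  by (rule vector_derivative_cong_eq)
    (auto intro: eventually_mono[OF eventually_upd[OF assms(2), of v]] assms(1))

lemma differentiable_cong:
  fixes g h :: jet_fun
  assumes "\<And>p. p \<in> M \<Longrightarrow> g p = h p" "p \<in> M"
    and "(\<lambda>s. g (p(v := s))) differentiable (at (p v))"
  shows "(\<lambda>s. h (p(v := s))) differentiable (at (p v))"
proof -
  have "((\<lambda>s. g (p(v := s))) has_vector_derivative pd v g p) (at (p v))"
    using assms(3) by (simp add: vector_derivative_works pd_def)
  then have "((\<lambda>s. h (p(v := s))) has_vector_derivative pd v g p) (at (p v))"
    by (subst has_vector_derivative_cong_ev[where g = "\<lambda>s. g (p(v := s))"])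
      (auto intro: eventually_mono[OF eventually_upd[OF assms(2), of v]] simp: assms(1,2))
  then show ?thesis by (rule differentiableI_vector)
qed

text \<open>Any class of continuous, coordinatewise differentiable functions that is closed under
  partial differentiation, up to equality on \<open>M\<close>, consists of smooth functions:
  iterated derivatives never leave it. This spares explicit formulas for higher derivatives.\<close>

lemma jet_smooth_coinduct:
  assumes "h \<in> S"
    and cont: "\<And>h. h \<in> S \<Longrightarrow> continuous_on M h"
    and diff: "\<And>h v p. h \<in> S \<Longrightarrow> p \<in> M \<Longrightarrow> (\<lambda>s. h (p(v := s))) differentiable (at (p v))"
    and step: "\<And>h v. h \<in> S \<Longrightarrow> \<exists>h'\<in>S. \<forall>p\<in>M. h' p = pd v h p"
  shows "jet_smooth M h"
proof -
  have *: "\<exists>h'\<in>S. \<forall>p\<in>M. h' p = foldr pd vs h p" for vs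
  proof (induction vs)
    case (Cons v vs)
    then obtain g where g: "g \<in> S" "\<forall>p\<in>M. g p = foldr pd vs h p" by blast
    obtain g' where "g' \<in> S" "\<forall>p\<in>M. g' p = pd v g p" using step[OF g(1)] by blast
    then show ?case using pd_cong[of g "foldr pd vs h"] g(2) by auto
  qed (use assms(1) in auto)
  show ?thesis
    unfolding jet_smooth_def
  proof (intro allI conjI ballI)
    fix vs
    obtain g where g: "g \<in> S" "\<forall>p\<in>M. g p = foldr pd vs h p" using * by blast
    then show "continuous_on M (foldr pd vs h)"
      using cont[OF g(1)] by (metis continuous_on_cong)
    fix v p assume p: "p \<in> M"
    show "(\<lambda>s. foldr pd vs h (p(v := s))) differentiable at (p v)"
      by (rule differentiable_cong[OF _ p diff[OF g(1) p]]) (use g in auto)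
  qed
qed

lemma jet_smooth_continuous: "jet_smooth M h \<Longrightarrow> continuous_on M h"
  unfolding jet_smooth_def by (metis foldr.simps(1) id_apply)

lemma jet_smooth_differentiable:
  "jet_smooth M h \<Longrightarrow> p \<in> M \<Longrightarrow> (\<lambda>s. h (p(v := s))) differentiable (at (p v))"
  unfolding jet_smooth_def by (metis foldr.simps(1) id_apply)

lemma jet_smooth_pd:
  assumes "jet_smooth M h"
  shows "jet_smooth M (pd v h)"
proof -
  have "foldr pd vs (pd v h) = foldr pd (vs @ [v]) h" for vs by simp
  with assms show ?thesis unfolding jet_smooth_def by metis
qed

lemma jet_smooth_cong:
  assumes "jet_smooth M g" "\<And>p. p \<in> M \<Longrightarrow> g p = h p"
  shows "jet_smooth M h"
proof (rule jet_smooth_coinduct[where S = "{h. \<exists>g. jet_smooth M g \<and> (\<forall>p\<in>M. g p = h p)}"])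
  show "h \<in> {h. \<exists>g. jet_smooth M g \<and> (\<forall>p\<in>M. g p = h p)}" using assms by blast
next
  fix k assume "k \<in> {h. \<exists>g. jet_smooth M g \<and> (\<forall>p\<in>M. g p = h p)}"
  then obtain g where g: "jet_smooth M g" and eq: "\<And>p. p \<in> M \<Longrightarrow> g p = k p" by blast
  show "continuous_on M k"
    using jet_smooth_continuous[OF g] eq by (metis continuous_on_cong)
  show "(\<lambda>s. k (p(v := s))) differentiable at (p v)" if "p \<in> M" for v p
    using differentiable_cong[OF eq that jet_smooth_differentiable[OF g that]] .
  show "\<exists>h'\<in>{h. \<exists>g. jet_smooth M g \<and> (\<forall>p\<in>M. g p = h p)}. \<forall>p\<in>M. h' p = pd v k p" for v
    using jet_smooth_pd[OF g, of v] pd_cong[of g k, OF eq, where v = v] by blast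
qed

section \<open>Differentiation rules and closure of smooth functions\<close>

lemma has_pd:
  "jet_smooth M h \<Longrightarrow> p \<in> M \<Longrightarrow> ((\<lambda>s. h (p(v := s))) has_vector_derivative pd v h p) (at (p v))"
  using jet_smooth_differentiable by (simp add: vector_derivative_works pd_def)

lemma has_pd_line:
  assumes "jet_smooth M h" "p(v := s) \<in> M"
  shows "((\<lambda>s. h (p(v := s))) has_vector_derivative pd v h (p(v := s))) (at s)"
  using has_pd[OF assms, of v] by simp

lemma pd_eqI: "((\<lambda>s. h (p(v := s))) has_vector_derivative d) (at (p v)) \<Longrightarrow> pd v h p = d"
  unfolding pd_def by (rule vector_derivative_at)

lemma has_pd_add:
  assumes "jet_smooth M g" "jet_smooth M h" "p \<in> M"
  shows "((\<lambda>s. (g + h) (p(v := s))) has_vector_derivative pd v g p + pd v h p) (at (p v))"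
  using has_vector_derivative_add[OF has_pd[OF assms(1,3)] has_pd[OF assms(2,3)]] by simp

lemma has_pd_mult:
  assumes "jet_smooth M g" "jet_smooth M h" "p \<in> M"
  shows "((\<lambda>s. (g * h) (p(v := s))) has_vector_derivative pd v g p * h p + g p * pd v h p) (at (p v))"
  using has_vector_derivative_mult[OF has_pd[OF assms(1,3), of v] has_pd[OF assms(2,3), of v]]
  by (simp add: add.commute)

lemma jet_smooth_add:
  assumes "jet_smooth M g" "jet_smooth M h"
  shows "jet_smooth M (g + h)"
proof (rule jet_smooth_coinduct[where S = "{a + b |a b. jet_smooth M a \<and> jet_smooth M b}"])
  show "g + h \<in> {a + b |a b. jet_smooth M a \<and> jet_smooth M b}" using assms by blast
next
  fix k assume "k \<in> {a + b |a b. jet_smooth M a \<and> jet_smooth M b}"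
  then obtain a b where k: "k = a + b" and ab: "jet_smooth M a" "jet_smooth M b" by blast
  show "continuous_on M k"
    unfolding k plus_fun_def by (intro continuous_on_add jet_smooth_continuous ab)
  show "(\<lambda>s. k (p(v := s))) differentiable at (p v)" if "p \<in> M" for v p
    unfolding k using has_pd_add[OF ab that] by (rule differentiableI_vector)
  show "\<exists>h'\<in>{a + b |a b. jet_smooth M a \<and> jet_smooth M b}. \<forall>p\<in>M. h' p = pd v k p" for v
  proof (rule bexI[of _ "pd v a + pd v b"])
    show "\<forall>p\<in>M. (pd v a + pd v b) p = pd v k p"
      unfolding k using pd_eqI has_pd_add[OF ab] by (metis plus_fun_apply)
  qed (use ab in \<open>blast intro: jet_smooth_pd\<close>)
qed

text \<open>Products alone are not closed under differentiation; sums of products are, by the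
  Leibniz rule, and so serve as the class for \<open>jet_smooth_coinduct\<close>.\<close>

inductive_set smooth_products :: "jet_fun set" where
  prod: "jet_smooth M a \<Longrightarrow> jet_smooth M b \<Longrightarrow> a * b \<in> smooth_products"
| add: "g \<in> smooth_products \<Longrightarrow> h \<in> smooth_products \<Longrightarrow> g + h \<in> smooth_products"

lemma smooth_products_step:
  assumes "h \<in> smooth_products"
  shows "continuous_on M h \<and> (\<forall>v. \<exists>h'\<in>smooth_products. \<forall>p\<in>M.
    ((\<lambda>s. h (p(v := s))) has_vector_derivative h' p) (at (p v)))"
  using assms
proof induction
  case (prod a b)
  show ?case
  proof (intro conjI allI)
    show "continuous_on M (a * b)"
      unfolding times_fun_def by (intro continuous_on_mult jet_smooth_continuous prod)
    fix v
    show "\<exists>h'\<in>smooth_products. \<forall>p\<in>M.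
        ((\<lambda>s. (a * b) (p(v := s))) has_vector_derivative h' p) (at (p v))"
      by (rule bexI[of _ "pd v a * b + a * pd v b"])
        (use prod has_pd_mult[OF prod] in \<open>auto intro!: smooth_products.intros jet_smooth_pd\<close>)
  qed
next
  case (add g h)
  show ?case
  proof (intro conjI allI)
    show "continuous_on M (g + h)"
      unfolding plus_fun_def by (intro continuous_on_add) (use add in auto)
    fix v
    obtain g' h' where "g' \<in> smooth_products" "h' \<in> smooth_products"
      "\<forall>p\<in>M. ((\<lambda>s. g (p(v := s))) has_vector_derivative g' p) (at (p v))"
      "\<forall>p\<in>M. ((\<lambda>s. h (p(v := s))) has_vector_derivative h' p) (at (p v))"
      using add by meson
    then show "\<exists>h'\<in>smooth_products. \<forall>p\<in>M.
        ((\<lambda>s. (g + h) (p(v := s))) has_vector_derivative h' p) (at (p v))"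
      by (intro bexI[of _ "g' + h'"]) (auto intro!: smooth_products.intros has_vector_derivative_add)
  qed
qed

lemma jet_smooth_mult:
  assumes "jet_smooth M g" "jet_smooth M h"
  shows "jet_smooth M (g * h)"
proof (rule jet_smooth_coinduct[where S = smooth_products])
  fix h v
  assume "h \<in> smooth_products"
  then obtain h' where h': "h' \<in> smooth_products"
    "\<forall>p\<in>M. ((\<lambda>s. h (p(v := s))) has_vector_derivative h' p) (at (p v))"
    using smooth_products_step by meson
  then show "\<exists>h'\<in>smooth_products. \<forall>p\<in>M. h' p = pd v h p"
    using pd_eqI by metis
  show "(\<lambda>s. h (p(v := s))) differentiable (at (p v))" if "p \<in> M" for p
    using h'(2) that differentiableI_vector by blast
qed (use smooth_products_step assms in \<open>auto intro: smooth_products.intros\<close>)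

lemma pd_const: "pd v (\<lambda>p. c) p = 0"
  by (rule pd_eqI) simp

lemma jet_smooth_const: "jet_smooth M (\<lambda>p. c)"
  by (rule jet_smooth_coinduct[where S = "range (\<lambda>c p. c)"]) (auto simp: pd_const)

lemma has_pd_coord:
  "((\<lambda>s. of_real ((p(v := s)) w) :: complex) has_vector_derivative (if v = w then 1 else 0)) (at (p v))"
  by (auto intro!: derivative_eq_intros has_vector_derivative_of_real)

lemma pd_coord: "pd v (\<lambda>p. of_real (p w)) p = (if v = w then 1 else 0)"
  by (rule pd_eqI) (rule has_pd_coord)

lemma jet_smooth_coord: "jet_smooth M (\<lambda>p. of_real (p w))"
proof (rule jet_smooth_coinduct[where S = "insert (\<lambda>p. of_real (p w)) (range (\<lambda>c p. c))"])
  fix h v p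
  assume h: "h \<in> insert (\<lambda>p. of_real (p w) :: complex) (range (\<lambda>c p. c))"
  then show "(\<lambda>s. h (p(v := s))) differentiable at (p v)"
    using differentiableI_vector[OF has_pd_coord[of p v w]] by auto
  have "continuous_on UNIV h"
    using h by (auto intro!: continuous_intros)
  then show "continuous_on M h" by (rule continuous_on_subset) simp
next
  fix h v
  assume h: "h \<in> insert (\<lambda>p. of_real (p w) :: complex) (range (\<lambda>c p. c))"
  have "pd v (\<lambda>p. of_real (p w)) = (\<lambda>p. if v = w then 1 else 0)" "pd v (\<lambda>p. c) = (\<lambda>p. 0)" for c
    by (simp_all add: fun_eq_iff pd_coord pd_const)
  with h show "\<exists>h'\<in>insert (\<lambda>p. of_real (p w)) (range (\<lambda>c p. c)). \<forall>p\<in>M. h' p = pd v h p"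
    by auto
qed simp

lemma has_pd_exp:
  "((\<lambda>s. c * exp (\<mu> * of_real ((p(v := s)) Jt)) :: complex) has_vector_derivative
    (if v = Jt then c * \<mu> * exp (\<mu> * of_real (p Jt)) else 0)) (at (p v))"
proof (cases "v = Jt")
  case True
  have "((\<lambda>s. c * exp (\<mu> * of_real s) :: complex) has_vector_derivative
      c * \<mu> * exp (\<mu> * of_real (p Jt))) (at (p Jt))"
    by (rule has_vector_derivative_real_field[where f = "\<lambda>z. c * exp (\<mu> * z)"])
      (auto intro!: derivative_eq_intros)
  with True show ?thesis by simp
qed simp

lemma pd_exp:
  "pd v (\<lambda>p. c * exp (\<mu> * of_real (p Jt))) p
    = (if v = Jt then c * \<mu> * exp (\<mu> * of_real (p Jt)) else 0)"
  by (rule pd_eqI) (rule has_pd_exp)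

lemma jet_smooth_exp: "jet_smooth M (\<lambda>p. exp (\<mu> * of_real (p Jt)))"
proof (rule jet_smooth_coinduct[where S = "range (\<lambda>c p. c * exp (\<mu> * of_real (p Jt)))"])
  show "(\<lambda>p. exp (\<mu> * of_real (p Jt))) \<in> range (\<lambda>c p. c * exp (\<mu> * of_real (p Jt)) :: complex)"
    by (rule range_eqI[of _ _ 1]) simp
next
  fix h v p
  assume h: "h \<in> range (\<lambda>c p. c * exp (\<mu> * of_real (p Jt)) :: complex)"
  then show "(\<lambda>s. h (p(v := s))) differentiable at (p v)"
    using differentiableI_vector[OF has_pd_exp[of _ \<mu> p v]] by auto
  have "continuous_on UNIV h"
    using h by (auto intro!: continuous_intros)
  then show "continuous_on M h" by (rule continuous_on_subset) simp
next
  fix h v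
  assume "h \<in> range (\<lambda>c p. c * exp (\<mu> * of_real (p Jt)) :: complex)"
  then obtain c where c: "h = (\<lambda>p. c * exp (\<mu> * of_real (p Jt)))" by blast
  show "\<exists>h'\<in>range (\<lambda>c p. c * exp (\<mu> * of_real (p Jt))). \<forall>p\<in>M. h' p = pd v h p"
    by (rule bexI[of _ "\<lambda>p. (if v = Jt then c * \<mu> else 0) * exp (\<mu> * of_real (p Jt))"])
      (auto simp: c pd_exp)
qed

text \<open>Symmetry of second derivatives, from continuity of both mixed derivatives and the second
  difference over a small square.\<close>

lemma pd_swap:
  assumes h: "jet_smooth M h" and p: "p \<in> M"
  shows "pd v (pd w h) p = pd w (pd v h) p"
proof (cases "v = w")
  case False
  \<comment> \<open>The mean value theorem needs real values, so real and imaginary parts are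
    treated separately through \<open>R\<close>.\<close>
  have real: "R (pd v (pd w h) p) = R (pd w (pd v h) p)"
    if R: "bounded_linear R" for R :: "complex \<Rightarrow> real"
  proof -
    define P where "P x y = p(v := x, w := y)" for x y
    have P_p: "P (p v) (p w) = p" by (simp add: P_def)
    have v_line: "P x y = (P a y)(v := x)" for x y a
      using False by (auto simp: P_def fun_eq_iff)
    have w_line: "P x y = (P x b)(w := y)" for x y b
      by (simp add: P_def)
    have d_v: "((\<lambda>x. R (g (P x y))) has_real_derivative R (pd v g (P x y))) (at x)"
      if "jet_smooth M g" "P x y \<in> M" for g x y
      using has_pd_line[of g "P 0 y" v x] that R
      by (auto simp: has_real_derivative_iff_has_vector_derivative simp flip: v_line
          intro: bounded_linear.has_vector_derivative)
    have d_w: "((\<lambda>y. R (g (P x y))) has_real_derivative R (pd w g (P x y))) (at y)"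
      if "jet_smooth M g" "P x y \<in> M" for g x y
      using has_pd_line[of g "P x 0" w y] that R
      by (auto simp: has_real_derivative_iff_has_vector_derivative simp flip: w_line
          intro: bounded_linear.has_vector_derivative)
    define g1 g2 where "g1 = pd w (pd v h)" and "g2 = pd v (pd w h)"
    have "jet_smooth M g1" "jet_smooth M g2"
      by (simp_all add: g1_def g2_def jet_smooth_pd h)
    then have cont: "continuous_on M (\<lambda>q. R (g1 q))" "continuous_on M (\<lambda>q. R (g2 q))"
      by (auto intro: bounded_linear.continuous_on[OF R] jet_smooth_continuous)
    show ?thesis
    proof (rule ccontr)
      assume neq: "R (pd v (pd w h) p) \<noteq> R (pd w (pd v h) p)"
      \<comment> \<open>Half the supposed gap: on \<open>S\<close> each mixed derivative stays
        within \<delta> of its value at \<open>p\<close>, so the two cannot take a common value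
        there.\<close>
      define \<delta> where "\<delta> = \<bar>R (g1 p) - R (g2 p)\<bar> / 2"
      have \<delta>: "\<delta> > 0" using neq by (simp add: \<delta>_def g1_def g2_def)
      define S where "S = M \<inter> (\<lambda>q. R (g1 q)) -` ball (R (g1 p)) \<delta>
        \<inter> (M \<inter> (\<lambda>q. R (g2 q)) -` ball (R (g2 p)) \<delta>)"
      have "open S"
        unfolding S_def
        by (intro open_Int continuous_open_preimage cont open_M open_ball)
      then have "open ((\<lambda>z. p(v := fst z, w := snd z)) -` S)"
        by (rule open_vimage[OF _ continuous_on_upd2])
      moreover have "p \<in> S" using p \<delta> by (simp add: S_def)
      then have "(p v, p w) \<in> (\<lambda>z. p(v := fst z, w := snd z)) -` S" by simp
      ultimately obtain A B where AB: "open A" "open B" "p v \<in> A" "p w \<in> B"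
        "A \<times> B \<subseteq> (\<lambda>z. p(v := fst z, w := snd z)) -` S"
        by (elim open_prod_elim) auto
      obtain e1 where e1: "e1 > 0" "ball (p v) e1 \<subseteq> A"
        using AB(1,3) open_contains_ball by meson
      obtain e2 where e2: "e2 > 0" "ball (p w) e2 \<subseteq> B"
        using AB(2,4) open_contains_ball by meson
      \<comment> \<open>Halving keeps the closed square of side \<open>e\<close> inside the product
        of the open balls.\<close>
      define e where "e = min e1 e2 / 2"
      have e: "e > 0" using e1 e2 by (simp add: e_def)
      have PS: "P x y \<in> S" if "p v \<le> x" "x \<le> p v + e" "p w \<le> y" "y \<le> p w + e" for x y
      proof -
        have "x \<in> ball (p v) e1" "y \<in> ball (p w) e2"
          using that e1(1) e2(1) by (auto simp: dist_real_def e_def)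
        then have "(x, y) \<in> A \<times> B" using e1 e2 by blast
        with AB(5) show ?thesis by (auto simp: P_def)
      qed
      then have PM: "P x y \<in> M" if "p v \<le> x" "x \<le> p v + e" "p w \<le> y" "y \<le> p w + e" for x y
        using that by (simp add: S_def)
      obtain x1 y1 where 1: "p v < x1" "x1 < p v + e" "p w < y1" "y1 < p w + e"
        "R (h (P (p v + e) (p w + e))) - R (h (P (p v + e) (p w))) - R (h (P (p v) (p w + e)))
          + R (h (P (p v) (p w))) = e * (e * R (g1 (P x1 y1)))"
        unfolding g1_def
        by (rule second_difference_mean_value[of e "p v" "p w" "\<lambda>x y. R (h (P x y))"
              "\<lambda>x y. R (pd v h (P x y))" "\<lambda>x y. R (pd w (pd v h) (P x y))"])
          (use e in \<open>auto intro!: d_v d_w h jet_smooth_pd PM\<close>)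
      obtain y2 x2 where 2: "p w < y2" "y2 < p w + e" "p v < x2" "x2 < p v + e"
        "R (h (P (p v + e) (p w + e))) - R (h (P (p v) (p w + e))) - R (h (P (p v + e) (p w)))
          + R (h (P (p v) (p w))) = e * (e * R (g2 (P x2 y2)))"
        unfolding g2_def
        by (rule second_difference_mean_value[of e "p w" "p v" "\<lambda>y x. R (h (P x y))"
              "\<lambda>y x. R (pd w h (P x y))" "\<lambda>y x. R (pd v (pd w h) (P x y))"])
          (use e in \<open>auto intro!: d_v d_w h jet_smooth_pd PM\<close>)
      have "e * (e * R (g1 (P x1 y1))) = e * (e * R (g2 (P x2 y2)))"
        using 1(5) 2(5) by linarith
      then have "R (g1 (P x1 y1)) = R (g2 (P x2 y2))" using e by simp
      moreover have "P x1 y1 \<in> S" "P x2 y2 \<in> S"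
        using PS 1 2 by simp_all
      then have "\<bar>R (g1 p) - R (g1 (P x1 y1))\<bar> < \<delta>" "\<bar>R (g2 p) - R (g2 (P x2 y2))\<bar> < \<delta>"
        by (simp_all add: S_def dist_real_def)
      moreover have "\<bar>R (g1 p) - R (g2 p)\<bar> \<le> \<bar>R (g1 p) - c\<bar> + \<bar>R (g2 p) - c\<bar>" for c
        using abs_triangle_ineq4[of "R (g1 p) - c" "R (g2 p) - c"] by simp
      from this[of "R (g2 (P x2 y2))"]
      have "2 * \<delta> \<le> \<bar>R (g1 p) - R (g2 (P x2 y2))\<bar> + \<bar>R (g2 p) - R (g2 (P x2 y2))\<bar>"
        by (simp add: \<delta>_def)
      ultimately show False by linarith
    qed
  qed
  from real[OF bounded_linear_Re] real[OF bounded_linear_Im] show ?thesis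
    by (rule complex_eqI)
qed simp

section \<open>Dependence on finitely many variables\<close>

lemma pd_eq_0_if_depends_only:
  assumes "depends_only M V h" "v \<notin> V" "p \<in> M"
  shows "pd v h p = 0"
proof (rule pd_eqI)
  have "eventually (\<lambda>s. h (p(v := s)) = h p) (nhds (p v))"
    using eventually_upd[OF assms(3), of v]
  proof eventually_elim
    case (elim s)
    then show ?case using assms unfolding depends_only_def by (metis fun_upd_other)
  qed
  then show "((\<lambda>s. h (p(v := s))) has_vector_derivative 0) (at (p v))"
    by (subst has_vector_derivative_cong_ev[where g = "\<lambda>s. h p"])
      (auto elim: eventually_mono)
qed

lemma depends_only_pd:
  assumes "depends_only M V h"
  shows "depends_only M V (pd v h)"
proof (cases "v \<in> V")
  case True
  show ?thesis
    unfolding depends_only_def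
  proof (intro ballI impI)
    fix p q assume p: "p \<in> M" and q: "q \<in> M" and eq: "\<forall>v\<in>V. p v = q v"
    with True have v: "p v = q v" by simp
    have "eventually (\<lambda>s. h (p(v := s)) = h (q(v := s))) (nhds (p v))"
      using eventually_upd[OF p, of v] eventually_upd[OF q, of v, folded v]
    proof eventually_elim
      case (elim s)
      have "\<forall>w\<in>V. (p(v := s)) w = (q(v := s)) w" using eq by simp
      with elim assms show ?case unfolding depends_only_def by blast
    qed
    then have "eventually (\<lambda>s. s \<in> UNIV \<longrightarrow> h (p(v := s)) = h (q(v := s))) (nhds (p v))"
      by simp
    from vector_derivative_cong_eq[OF this v refl] show "pd v h p = pd v h q"
      by (simp add: pd_def)
  qed
next
  case False
  then show ?thesis
    using pd_eq_0_if_depends_only[OF assms] by (auto simp: depends_only_def)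
qed

lemma jet_function_pd: "jet_function M h \<Longrightarrow> jet_function M (pd v h)"
  unfolding jet_function_def by (auto intro: jet_smooth_pd depends_only_pd)

lemma jet_function_cong:
  assumes "jet_function M g" "\<And>p. p \<in> M \<Longrightarrow> g p = h p"
  shows "jet_function M h"
  using assms jet_smooth_cong[of g h] unfolding jet_function_def depends_only_def by metis

lemma depends_only_combine:
  assumes "depends_only M V g" "depends_only M W h"
  shows "depends_only M (V \<union> W) (\<lambda>p. c (g p) (h p))"
  using assms unfolding depends_only_def by (metis UnCI)

lemma jet_function_add:
  assumes "jet_function M g" "jet_function M h"
  shows "jet_function M (g + h)"
  using assms depends_only_combine[of _ g _ h "(+)"] jet_smooth_add[of g h]
  unfolding jet_function_def plus_fun_def by blast

lemma jet_function_mult: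
  assumes "jet_function M g" "jet_function M h"
  shows "jet_function M (g * h)"
  using assms depends_only_combine[of _ g _ h "(*)"] jet_smooth_mult[of g h]
  unfolding jet_function_def times_fun_def by blast

lemma jet_function_const: "jet_function M (\<lambda>p. c)"
  unfolding jet_function_def using jet_smooth_const
  by (auto simp: depends_only_def intro!: exI[of _ "{}"])

lemma jet_function_coord: "jet_function M (\<lambda>p. of_real (p w))"
  unfolding jet_function_def using jet_smooth_coord
  by (auto simp: depends_only_def intro!: exI[of _ "{w}"])

lemma jet_function_exp: "jet_function M (\<lambda>p. exp (\<mu> * of_real (p Jt)))"
  unfolding jet_function_def using jet_smooth_exp
  by (auto simp: depends_only_def intro!: exI[of _ "{Jt}"])

end

section \<open>Total derivative, linearization and bracket\<close>

lemma sum_fun_apply: "(sum h S :: _ \<Rightarrow> 'b::comm_monoid_add) p = (\<Sum>i\<in>S. h i p)"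
  by (induction S rule: infinite_finite_induct) simp_all

context jet_open
begin

definition jets :: "jet_fun set" where
  "jets = {h. jet_function M h}"

text \<open>
  The operators below agree with the given ones on \<open>M\<close> and vanish off \<open>M\<close>, so that identities
  valid on \<open>M\<close> become equations between elements of the ring of functions.
\<close>

definition dd :: "jet_var \<Rightarrow> jet_fun \<Rightarrow> jet_fun" where
  "dd v h = (\<lambda>p. if p \<in> M then pd v h p else 0)"

definition const_on :: "complex \<Rightarrow> jet_fun" where
  "const_on c = (\<lambda>p. if p \<in> M then c else 0)"

definition coord :: "jet_var \<Rightarrow> jet_fun" where
  "coord v = (\<lambda>p. of_real (p v))"

section \<open>The ring of jet functions and its partial derivatives\<close>

lemma jets_cong: "g \<in> jets \<Longrightarrow> (\<And>p. p \<in> M \<Longrightarrow> g p = h p) \<Longrightarrow> h \<in> jets"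
  unfolding jets_def using jet_function_cong by blast

lemma jets_add: "g \<in> jets \<Longrightarrow> h \<in> jets \<Longrightarrow> g + h \<in> jets"
  by (simp add: jets_def jet_function_add)

lemma jets_mult: "g \<in> jets \<Longrightarrow> h \<in> jets \<Longrightarrow> g * h \<in> jets"
  by (simp add: jets_def jet_function_mult)

lemma jets_const: "(\<lambda>p. c) \<in> jets"
  by (simp add: jets_def jet_function_const)

lemma jets_1: "1 \<in> jets"
  using jets_const[of 1] by (simp add: one_fun_def)

lemma jets_0: "0 \<in> jets"
  using jets_const[of 0] by (simp add: zero_fun_def)

lemma jets_const_on: "const_on c \<in> jets"
  using jets_const by (rule jets_cong) (simp add: const_on_def)

lemma jets_coord: "coord v \<in> jets"
  by (simp add: jets_def coord_def jet_function_coord)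

lemma jets_uminus: "g \<in> jets \<Longrightarrow> - g \<in> jets"
  using jets_mult[OF jets_const[of "- 1"], of g] by (simp add: fun_Compl_def times_fun_def)

lemma jets_diff: "g \<in> jets \<Longrightarrow> h \<in> jets \<Longrightarrow> g - h \<in> jets"
  using jets_add[of g "- h"] jets_uminus by simp

lemma jets_sum: "(\<And>i. i \<in> S \<Longrightarrow> h i \<in> jets) \<Longrightarrow> sum h S \<in> jets"
  by (induction S rule: infinite_finite_induct) (auto intro: jets_0 jets_add)

lemma jets_pd: "h \<in> jets \<Longrightarrow> pd v h \<in> jets"
  by (simp add: jets_def jet_function_pd)

lemma jets_dd: "h \<in> jets \<Longrightarrow> dd v h \<in> jets"
  by (rule jets_cong[OF jets_pd]) (auto simp: dd_def)

lemma jets_smooth: "h \<in> jets \<Longrightarrow> jet_smooth M h"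
  by (simp add: jets_def jet_function_def)

lemma dd_cong: "(\<And>p. p \<in> M \<Longrightarrow> g p = h p) \<Longrightarrow> dd v g = dd v h"
  using pd_cong[of g h] by (auto simp: dd_def fun_eq_iff)

lemma dd_add: "g \<in> jets \<Longrightarrow> h \<in> jets \<Longrightarrow> dd v (g + h) = dd v g + dd v h"
  by (auto simp: dd_def fun_eq_iff intro!: pd_eqI has_pd_add jets_smooth)

lemma dd_mult: "g \<in> jets \<Longrightarrow> h \<in> jets \<Longrightarrow> dd v (g * h) = dd v g * h + g * dd v h"
  by (auto simp: dd_def fun_eq_iff intro!: pd_eqI has_pd_mult jets_smooth)

lemma dd_const: "dd v (\<lambda>p. c) = 0"
  by (auto simp: dd_def fun_eq_iff pd_const)

lemma dd_0: "dd v 0 = 0"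
  using dd_const[of v 0] by (simp add: zero_fun_def)

lemma dd_const_on: "dd v (const_on c) = 0"
  using dd_cong[of "const_on c" "\<lambda>p. c" v] by (simp add: const_on_def dd_const)

lemma dd_uminus: "g \<in> jets \<Longrightarrow> dd v (- g) = - dd v g"
  using dd_add[of g "- g" v] by (simp add: jets_uminus dd_0 eq_neg_iff_add_eq_0 add.commute)

lemma dd_diff: "g \<in> jets \<Longrightarrow> h \<in> jets \<Longrightarrow> dd v (g - h) = dd v g - dd v h"
  using dd_add[of g "- h" v] by (simp add: jets_uminus dd_uminus)

lemma dd_sum: "(\<And>i. i \<in> S \<Longrightarrow> h i \<in> jets) \<Longrightarrow> dd v (sum h S) = (\<Sum>i\<in>S. dd v (h i))"
  by (induction S rule: infinite_finite_induct) (auto simp: dd_0 dd_add jets_sum)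

lemma dd_coord: "dd v (coord w) = (if v = w then const_on 1 else 0)"
  by (auto simp: dd_def coord_def const_on_def fun_eq_iff pd_coord)

lemma dd_const_on_mult: "g \<in> jets \<Longrightarrow> dd v (const_on c * g) = const_on c * dd v g"
  by (simp add: dd_mult jets_const_on dd_const_on)

lemma const_on_1_dd: "const_on 1 * dd v h = dd v h"
  by (auto simp: const_on_def dd_def fun_eq_iff)

lemma dd_swap: "h \<in> jets \<Longrightarrow> dd v (dd w h) = dd w (dd v h)"
  using dd_cong[of "dd w h" "pd w h" v] dd_cong[of "dd v h" "pd v h" w]
  by (auto simp: dd_def fun_eq_iff pd_swap jets_smooth)

text \<open>A strict bound instead of the exact order: several functions can share one
  \<open>N\<close>, and \<open>N = 0\<close> describes functions whose derivatives in all the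
  \<open>Ju i\<close> vanish.\<close>

definition order_below :: "nat \<Rightarrow> jet_fun \<Rightarrow> bool" where
  "order_below N h \<longleftrightarrow> (\<forall>i\<ge>N. dd (Ju i) h = 0)"

lemma order_below_exists:
  assumes "h \<in> jets"
  obtains N where "order_below N h"
proof -
  obtain V where V: "finite V" "depends_only M V h"
    using assms by (auto simp: jets_def jet_function_def)
  have "finite (Ju -` V)"
    by (rule finite_vimageI[OF V(1)]) (simp add: inj_def)
  then obtain N where N: "\<forall>i\<in>Ju -` V. i < N"
    using finite_nat_set_iff_bounded by blast
  have "order_below N h"
    unfolding order_below_def
  proof (intro allI impI ext)
    fix i p assume "N \<le> i"
    with N have "Ju i \<notin> V" by (metis vimageI2 leD)
    then show "dd (Ju i) h p = 0 p"
      using pd_eq_0_if_depends_only[OF V(2)] by (simp add: dd_def)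
  qed
  then show ?thesis by (rule that)
qed

lemma dd_eq_0D: "dd v h = 0 \<Longrightarrow> p \<in> M \<Longrightarrow> pd v h p = 0"
  by (metis dd_def zero_fun_apply)

definition DD :: "jet_fun \<Rightarrow> jet_fun" where
  "DD h = (\<lambda>p. if p \<in> M then total_D h p else 0)"

text \<open>\<open>total_D\<close> sums over an index set that changes with the point; a fixed
  finite range turns it into an identity between ring elements.\<close>

lemma DD_eq:
  assumes "order_below N h"
  shows "DD h = dd Jx h + (\<Sum>i<N. coord (Ju (Suc i)) * dd (Ju i) h)"
proof
  fix p
  show "DD h p = (dd Jx h + (\<Sum>i<N. coord (Ju (Suc i)) * dd (Ju i) h)) p"
  proof (cases "p \<in> M")
    case True
    have "(\<Sum>i | pd (Ju i) h p \<noteq> 0. of_real (p (Ju (Suc i))) * pd (Ju i) h p)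
        = (\<Sum>i<N. of_real (p (Ju (Suc i))) * pd (Ju i) h p)"
      using dd_eq_0D[OF _ True] assms
      by (intro sum.mono_neutral_left) (auto simp: order_below_def not_le[symmetric])
    with True show ?thesis
      by (simp add: DD_def total_D_def dd_def coord_def sum_fun_apply)
  qed (simp add: DD_def dd_def sum_fun_apply)
qed

lemma jets_DD:
  assumes "h \<in> jets"
  shows "DD h \<in> jets"
proof -
  obtain N where N: "order_below N h" using order_below_exists[OF assms] by blast
  show ?thesis
    unfolding DD_eq[OF N] using assms by (intro jets_add jets_sum jets_mult jets_coord jets_dd)
qed

lemma order_below_exists2:
  assumes "g \<in> jets" "h \<in> jets"
  obtains N where "order_below N g" "order_below N h"
proof -
  obtain N1 N2 where "order_below N1 g" "order_below N2 h"
    using order_below_exists assms by metis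
  then show ?thesis using that[of "max N1 N2"] by (simp add: order_below_def)
qed

sublocale all: differential_subring jets DD
proof
  fix a b assume ab: "a \<in> jets" "b \<in> jets"
  obtain N where N: "order_below N a" "order_below N b"
    using order_below_exists2[OF ab] by blast
  have "order_below N (a + b)" "order_below N (a * b)"
    using N ab by (simp_all add: order_below_def dd_add dd_mult)
  note DD_ab = DD_eq[OF this(1)] DD_eq[OF this(2)] DD_eq[OF N(1)] DD_eq[OF N(2)]
  show "DD (a + b) = DD a + DD b"
    using ab by (simp add: DD_ab dd_add algebra_simps sum.distrib)
  show "DD (a * b) = DD a * b + a * DD b"
    using ab by (simp add: DD_ab dd_mult algebra_simps sum.distrib sum_distrib_left sum_distrib_right)
qed (auto intro: jets_1 jets_add jets_uminus jets_mult jets_DD)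

lemma DD_0: "DD 0 = 0"
  by (rule all.D_0)

text \<open>The coefficients \<open>coord (Ju i)\<close> of \<open>DD\<close> involve neither x nor
  t, and partial derivatives commute.\<close>

lemma dd_DD:
  assumes h: "h \<in> jets" and v: "v = Jx \<or> v = Jt"
  shows "dd v (DD h) = DD (dd v h)"
proof -
  obtain N where N: "order_below N h" using order_below_exists[OF h] by blast
  then have "order_below N (dd v h)"
    using h by (simp add: order_below_def dd_swap[of h _ v] dd_0)
  note DD_h = DD_eq[OF N] DD_eq[OF this]
  have "dd v (coord (Ju i) * dd (Ju j) h) = coord (Ju i) * dd (Ju j) (dd v h)" for i j
    using h v by (auto simp: dd_mult jets_coord jets_dd dd_coord dd_swap[of h _ "Ju j"])
  then show ?thesis
    using h by (simp add: DD_h dd_add dd_sum jets_dd jets_sum jets_mult jets_coord dd_swap[of h v Jx])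
qed

text \<open>The extra term arises when the derivative hits the coefficient
  \<open>coord (Ju (Suc i))\<close>. It is the index shift that makes symbols follow the rule
  \<open>shift\<close>.\<close>

lemma dd_Ju_DD:
  assumes h: "h \<in> jets"
  shows "dd (Ju s) (DD h) = DD (dd (Ju s) h) + (case s of 0 \<Rightarrow> 0 | Suc i \<Rightarrow> dd (Ju i) h)"
proof -
  obtain N where N: "order_below N h" using order_below_exists[OF h] by blast
  then have "order_below N (dd (Ju s) h)"
    using h by (simp add: order_below_def dd_swap[of h _ "Ju s"] dd_0)
  note DD_h = DD_eq[OF N] DD_eq[OF this]
  have "dd (Ju s) (coord (Ju (Suc i)) * dd (Ju i) h)
      = (if s = Suc i then dd (Ju i) h else 0) + coord (Ju (Suc i)) * dd (Ju i) (dd (Ju s) h)" for i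
    using h by (simp add: dd_mult jets_coord jets_dd dd_coord dd_swap[of h _ "Ju i"] const_on_1_dd)
  moreover have "(\<Sum>i<N. if s = Suc i then dd (Ju i) h else 0)
      = (case s of 0 \<Rightarrow> 0 | Suc i \<Rightarrow> dd (Ju i) h)"
    using N by (auto simp: order_below_def split: nat.split)
  ultimately show ?thesis
    using h by (simp add: DD_h dd_add dd_sum jets_dd jets_sum jets_mult jets_coord sum.distrib
        dd_swap[of h "Ju s" Jx])
qed

text \<open>By \<open>dd_Ju_DD\<close> the total derivative raises the order by one and keeps the
  leading coefficient. Descending from the bound \<open>N\<close>, each derivative of
  \<open>h\<close> in turn must vanish.\<close>

lemma dd_Ju_eq_0_if_DD:
  assumes h: "h \<in> jets" and DD_h: "\<And>s. dd (Ju s) (DD h) = 0"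
  shows "dd (Ju s) h = 0"
proof -
  obtain N where N: "order_below N h" using order_below_exists[OF h] by blast
  show ?thesis
  proof (cases "s \<le> N")
    case True
    then show ?thesis
    proof (induction rule: inc_induct)
      case (step i)
      then show ?case using dd_Ju_DD[OF h, of "Suc i"] DD_h by (auto simp: DD_0 simp del: zero_fun_apply)
    qed (use N in \<open>simp add: order_below_def\<close>)
  qed (use N in \<open>simp add: order_below_def\<close>)
qed

definition jets_x :: "jet_fun set" where
  "jets_x = {h \<in> jets. dd Jx h = 0}"

text \<open>Without x the hypothesis \<open>no_antiderivative\<close> holds
  (\<open>DD_DD_eq_0\<close>); with x it fails, since x has total derivative 1, which is
  constant.\<close>

sublocale xfree: differential_subring jets_x DD
  by standard
    (auto simp: jets_x_def dd_add dd_mult dd_uminus dd_DD all.D_0 all.D_add all.D_mult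
      jets_1 jets_add jets_uminus jets_mult jets_DD dd_const[of _ 1, folded one_fun_def])

lemma DD_eq_dd_Jx: "(\<And>s. dd (Ju s) h = 0) \<Longrightarrow> DD h = dd Jx h"
  using DD_eq[of 0 h] by (simp add: order_below_def)

lemma DD_eq_0_imp:
  assumes "h \<in> jets" "DD h = 0"
  shows "dd (Ju s) h = 0" "dd Jx h = 0"
proof -
  show *: "dd (Ju s) h = 0" for s
    using dd_Ju_eq_0_if_DD[OF assms(1)] assms(2) by (simp add: dd_0)
  show "dd Jx h = 0" using DD_eq_dd_Jx[OF *] assms(2) by simp
qed

text \<open>The vanishing second derivative removes all \<open>Ju s\<close> from
  \<open>DD h\<close>, hence from \<open>h\<close>; then \<open>DD h\<close> is only the
  x-derivative, which is zero.\<close>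

lemma DD_DD_eq_0:
  assumes "h \<in> jets_x" "DD (DD h) = 0"
  shows "DD h = 0"
proof -
  have "dd (Ju s) (DD h) = 0" for s
    using DD_eq_0_imp(1)[of "DD h"] assms by (simp add: jets_x_def jets_DD)
  then have "dd (Ju s) h = 0" for s
    using dd_Ju_eq_0_if_DD[of h] assms(1) by (simp add: jets_x_def)
  then show ?thesis using DD_eq_dd_Jx[of h] assms(1) by (simp add: jets_x_def)
qed

lemma jets_DD_pow: "h \<in> jets \<Longrightarrow> (DD ^^ i) h \<in> jets"
  by (induction i) (auto intro: jets_DD)

lemma DD_pow_0: "(DD ^^ i) 0 = 0"
  by (induction i) (auto simp: DD_0 simp del: zero_fun_apply)

lemma DD_pow_add: "g \<in> jets \<Longrightarrow> h \<in> jets \<Longrightarrow> (DD ^^ i) (g + h) = (DD ^^ i) g + (DD ^^ i) h"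
  by (induction i) (auto simp: all.D_add jets_DD_pow)

lemma DD_const_on: "DD (const_on c) = 0"
  by (simp add: DD_eq_dd_Jx dd_const_on)

lemma DD_pow_const_on_mult: "h \<in> jets \<Longrightarrow> (DD ^^ i) (const_on c * h) = const_on c * (DD ^^ i) h"
  by (induction i) (auto simp: all.D_mult jets_const_on jets_DD_pow DD_const_on)

lemma dd_DD_pow: "h \<in> jets \<Longrightarrow> v = Jx \<or> v = Jt \<Longrightarrow> dd v ((DD ^^ i) h) = (DD ^^ i) (dd v h)"
  by (induction i) (simp_all add: dd_DD jets_DD_pow)

section \<open>Linearization and bracket as operations on the ring\<close>

definition lin :: "jet_fun \<Rightarrow> jet_fun \<Rightarrow> jet_fun" where
  "lin h r = (\<Sum>i | dd (Ju i) h \<noteq> 0. dd (Ju i) h * (DD ^^ i) r)"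

definition brk :: "jet_fun \<Rightarrow> jet_fun \<Rightarrow> jet_fun" where
  "brk h r = lin h r - lin r h"

lemma lin_eq:
  assumes "order_below N h"
  shows "lin h r = (\<Sum>i<N. dd (Ju i) h * (DD ^^ i) r)"
  unfolding lin_def using assms
  by (intro sum.mono_neutral_left) (auto simp: order_below_def not_le[symmetric])

lemma lin_0_left: "lin 0 r = 0"
  by (simp add: lin_def dd_0)

lemma lin_0_right: "lin h 0 = 0"
  by (simp add: lin_def DD_pow_0)

lemma lin_add_left:
  assumes "g \<in> jets" "h \<in> jets"
  shows "lin (g + h) r = lin g r + lin h r"
proof -
  obtain N where N: "order_below N g" "order_below N h"
    using order_below_exists2[OF assms] by blast
  then have "order_below N (g + h)" using assms by (simp add: order_below_def dd_add)
  from lin_eq[OF this] lin_eq[OF N(1)] lin_eq[OF N(2)] show ?thesis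
    using assms by (simp add: dd_add algebra_simps sum.distrib)
qed

lemma lin_const_on_mult_left:
  assumes "h \<in> jets"
  shows "lin (const_on c * h) r = const_on c * lin h r"
proof -
  obtain N where N: "order_below N h" using order_below_exists[OF assms] by blast
  then have "order_below N (const_on c * h)" using assms by (simp add: order_below_def dd_const_on_mult)
  from lin_eq[OF this] lin_eq[OF N(1)] show ?thesis
    using assms by (simp add: dd_const_on_mult sum_distrib_left mult.assoc)
qed

lemma lin_add_right: "g \<in> jets \<Longrightarrow> h \<in> jets \<Longrightarrow> lin r (g + h) = lin r g + lin r h"
  by (simp add: lin_def DD_pow_add algebra_simps sum.distrib)

lemma lin_const_on_mult_right: "h \<in> jets \<Longrightarrow> lin r (const_on c * h) = const_on c * lin r h"
  by (simp add: lin_def DD_pow_const_on_mult sum_distrib_left mult.left_commute)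

lemma jets_lin: "h \<in> jets \<Longrightarrow> r \<in> jets \<Longrightarrow> lin h r \<in> jets"
  unfolding lin_def by (intro jets_sum jets_mult jets_dd jets_DD_pow)

lemma dd_lin:
  assumes h: "h \<in> jets" and r: "r \<in> jets" and v: "v = Jx \<or> v = Jt"
  shows "dd v (lin h r) = lin (dd v h) r + lin h (dd v r)"
proof -
  obtain N where N: "order_below N h" using order_below_exists[OF h] by blast
  then have "order_below N (dd v h)"
    using h by (simp add: order_below_def dd_swap[of h _ v] dd_0)
  from lin_eq[OF this] lin_eq[OF N] show ?thesis
    using h r by (simp add: dd_sum dd_mult jets_dd jets_mult jets_DD_pow dd_DD_pow[OF r v]
        dd_swap[of h v] sum.distrib)
qed

lemma dd_brk:
  assumes "F \<in> jets" "G \<in> jets" "v = Jx \<or> v = Jt" "dd v F = 0"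
  shows "dd v (brk F G) = brk F (dd v G)"
  using assms by (simp add: brk_def dd_diff jets_lin dd_lin lin_0_left lin_0_right)

lemma brk_add_right: "F \<in> jets \<Longrightarrow> g \<in> jets \<Longrightarrow> h \<in> jets \<Longrightarrow> brk F (g + h) = brk F g + brk F h"
  by (simp add: brk_def lin_add_left lin_add_right)

lemma brk_const_on_mult_right: "F \<in> jets \<Longrightarrow> h \<in> jets \<Longrightarrow> brk F (const_on c * h) = const_on c * brk F h"
  by (simp add: brk_def lin_const_on_mult_left lin_const_on_mult_right right_diff_distrib)

lemma total_D_pow_eq: "p \<in> M \<Longrightarrow> (total_D ^^ i) r p = (DD ^^ i) r p"
proof (induction i arbitrary: p)
  case (Suc i)
  have "pd v ((total_D ^^ i) r) p = pd v ((DD ^^ i) r) p" for v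
    using pd_cong[of "(total_D ^^ i) r" "(DD ^^ i) r" p v] Suc by simp
  with Suc.prems show ?case
    by (simp add: DD_def[of "(DD ^^ i) r"] total_D_def[of "(total_D ^^ i) r"] total_D_def[of "(DD ^^ i) r"])
qed simp

lemma linearization_eq:
  assumes h: "h \<in> jets" and p: "p \<in> M"
  shows "linearization h r p = lin h r p"
proof -
  obtain N where N: "order_below N h" using order_below_exists[OF h] by blast
  have "linearization h r p = (\<Sum>i<N. pd (Ju i) h p * (total_D ^^ i) r p)"
    unfolding linearization_def using dd_eq_0D[OF _ p] N
    by (intro sum.mono_neutral_left) (auto simp: order_below_def not_le[symmetric])
  then show ?thesis
    using p by (simp add: lin_eq[OF N] sum_fun_apply dd_def total_D_pow_eq)
qed

lemma brk_off: "p \<notin> M \<Longrightarrow> brk h r p = 0"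
  by (simp add: brk_def lin_def dd_def sum_fun_apply)

text \<open>Both sides of the symmetry condition vanish off \<open>M\<close> in the truncated
  version, so the condition on \<open>M\<close> becomes one equation of functions.\<close>

lemma symmetries_eq:
  assumes "F \<in> jets"
  shows "symmetries M F = {G \<in> jets. dd Jt G = brk F G}"
proof -
  have "(\<forall>p\<in>M. pd Jt G p = jet_bracket F G p) \<longleftrightarrow> dd Jt G = brk F G" if "G \<in> jets" for G
    unfolding fun_eq_iff using assms that brk_off[of _ F G]
    by (auto simp: dd_def jet_bracket_def linearization_eq brk_def)
  then show ?thesis
    by (auto simp: symmetries_def jets_def)
qed

text \<open>The symbol of the linearization operator of \<open>h\<close>, with \<open>D\<close> read
  as the polynomial variable.\<close>

definition symb :: "jet_fun \<Rightarrow> jet_fun poly" where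
  "symb h = (\<Sum>i | dd (Ju i) h \<noteq> 0. monom (dd (Ju i) h) i)"

lemma coeff_symb:
  assumes "h \<in> jets"
  shows "coeff (symb h) s = dd (Ju s) h"
proof -
  obtain N where "order_below N h" using order_below_exists[OF assms] by blast
  then have "{i. dd (Ju i) h \<noteq> 0} \<subseteq> {..<N}"
    by (auto simp: order_below_def not_le[symmetric])
  then have "finite {i. dd (Ju i) h \<noteq> 0}"
    by (rule finite_subset) simp
  then show ?thesis
    by (auto simp: symb_def coeff_sum)
qed

lemma shift_symb: "h \<in> jets \<Longrightarrow> all.shift (symb h) = symb (DD h)"
  by (rule poly_eqI)
    (simp add: all.coeff_shift coeff_symb jets_DD dd_Ju_DD coeff_pCons split: nat.split)

lemma shift_pow_symb: "h \<in> jets \<Longrightarrow> (all.shift ^^ i) (symb h) = symb ((DD ^^ i) h)"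
  by (induction i) (auto simp: shift_symb jets_DD_pow)

lemma degree_symb_le: "h \<in> jets \<Longrightarrow> (\<And>i. i > m \<Longrightarrow> dd (Ju i) h = 0) \<Longrightarrow> degree (symb h) \<le> m"
  by (rule degree_le) (simp add: coeff_symb)

text \<open>The derivative falls either on the coefficients of the linearization of
  \<open>h\<close>, giving the first term, or on the iterated total derivatives of \<open>r\<close>.
  The latter collect into a coefficient of the composed operators.\<close>

lemma dd_Ju_lin:
  assumes h: "h \<in> jets" and r: "r \<in> jets"
  shows "dd (Ju s) (lin h r) = lin (dd (Ju s) h) r + coeff (all.act (symb h) (symb r)) s"
proof -
  obtain N where N: "order_below N h" using order_below_exists[OF h] by blast
  then have N': "order_below N (dd (Ju s) h)"
    using h by (simp add: order_below_def dd_swap[of h _ "Ju s"] dd_0)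
  have deg: "degree (symb h) \<le> N"
    by (rule degree_symb_le[OF h]) (use N in \<open>simp add: order_below_def\<close>)
  have "coeff (all.act (symb h) (symb r)) s = (\<Sum>i<N. dd (Ju i) h * dd (Ju s) ((DD ^^ i) r))"
    using h r N
    by (simp add: order_below_def all.act_eq[OF deg] coeff_sum coeff_symb shift_pow_symb jets_DD_pow
        flip: lessThan_Suc_atMost)
  then show ?thesis
    using h r by (simp add: lin_eq[OF N] lin_eq[OF N'] dd_sum dd_mult jets_dd jets_mult jets_DD_pow
        sum.distrib dd_swap[of h "Ju s"])
qed

lemma dd_Ju_brk:
  assumes "F \<in> jets" "G \<in> jets"
  shows "dd (Ju s) (brk F G) = lin (dd (Ju s) F) G - lin (dd (Ju s) G) F
    + coeff (all.commutator (symb F) (symb G)) s"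
  using assms by (simp add: brk_def dd_diff jets_lin dd_Ju_lin all.commutator_def)

end

section \<open>Leading coefficients of symmetries\<close>

lemma power_fun_apply: "(f ^ k) x = (f x :: 'b::monoid_mult) ^ k"
  by (induction k) simp_all

context jet_open
begin

definition symmetry_jets :: "jet_fun \<Rightarrow> jet_fun set" where
  "symmetry_jets F = {G \<in> jets. dd Jt G = brk F G}"

definition time_op :: "complex \<Rightarrow> jet_fun \<Rightarrow> jet_fun" where
  "time_op c h = dd Jt h - const_on c * h"

text \<open>Admissible exponents are collected in \<Lambda>, so that both claims are handled at
  once: \<open>{0}\<close> belongs to polynomials in t and \<open>UNIV\<close> to
  quasipolynomials.\<close>

definition annihilated :: "complex set \<Rightarrow> jet_fun \<Rightarrow> bool" where
  "annihilated \<Lambda> h \<longleftrightarrow> (\<exists>cs. set cs \<subseteq> \<Lambda> \<and> foldr time_op cs h = 0)"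

lemma jets_time_op: "h \<in> jets \<Longrightarrow> time_op c h \<in> jets"
  by (simp add: time_op_def jets_diff jets_dd jets_mult jets_const_on)

lemma time_op_zero: "time_op c 0 = 0"
  by (simp add: time_op_def dd_0)

lemma dd_time_op: "h \<in> jets \<Longrightarrow> dd v (time_op c h) = time_op c (dd v h)"
  by (simp add: time_op_def dd_diff jets_dd jets_mult jets_const_on dd_const_on_mult dd_swap[of h v])

lemma time_op_0_eq: "time_op 0 h = dd Jt h"
  by (rule ext) (simp add: time_op_def const_on_def)

lemma jets_foldr_time_op: "h \<in> jets \<Longrightarrow> foldr time_op cs h \<in> jets"
  by (induction cs) (auto intro: jets_time_op)

lemma foldr_time_op_zero: "foldr time_op cs 0 = 0"
  by (induction cs) (auto simp: time_op_zero simp del: zero_fun_apply)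

lemma dd_foldr_time_op: "h \<in> jets \<Longrightarrow> dd v (foldr time_op cs h) = foldr time_op cs (dd v h)"
  by (induction cs) (auto simp: dd_time_op jets_foldr_time_op)

lemma brk_diff_right:
  "F \<in> jets \<Longrightarrow> g \<in> jets \<Longrightarrow> h \<in> jets \<Longrightarrow> brk F (g - h) = brk F g - brk F h"
  using brk_add_right[of F "g - h" h] by (simp add: jets_diff)

lemma symmetry_jets_dd:
  "F \<in> jets \<Longrightarrow> v = Jx \<or> v = Jt \<Longrightarrow> dd v F = 0 \<Longrightarrow> G \<in> symmetry_jets F \<Longrightarrow> dd v G \<in> symmetry_jets F"
  by (auto simp: symmetry_jets_def jets_dd dd_brk dd_swap[of G Jt] simp del: zero_fun_apply)

lemma symmetry_jets_time_op:
  assumes F: "F \<in> jets" "dd Jt F = 0" and G: "G \<in> symmetry_jets F"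
  shows "time_op c G \<in> symmetry_jets F"
proof -
  have G': "G \<in> jets" "dd Jt G = brk F G" using G by (auto simp: symmetry_jets_def)
  have "dd Jt (time_op c G) = time_op c (brk F G)"
    using dd_time_op[OF G'(1)] G'(2) by simp
  also have "\<dots> = brk F (dd Jt G) - brk F (const_on c * G)"
    using dd_brk[OF F(1) G'(1) _ F(2)] by (simp add: time_op_def brk_const_on_mult_right F G')
  also have "\<dots> = brk F (time_op c G)"
    unfolding time_op_def using F G' by (intro brk_diff_right[symmetric] jets_dd jets_mult jets_const_on)
  finally show ?thesis using G' by (simp add: symmetry_jets_def jets_time_op)
qed

lemma symmetry_jets_foldr_time_op:
  "F \<in> jets \<Longrightarrow> dd Jt F = 0 \<Longrightarrow> G \<in> symmetry_jets F \<Longrightarrow> foldr time_op cs G \<in> symmetry_jets F"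
  by (induction cs) (auto intro: symmetry_jets_time_op)

lemma lin_const_on_left: "lin (const_on c) r = 0"
  by (simp add: lin_def dd_const_on)

lemma symb_symbols: "h \<in> jets \<Longrightarrow> symb h \<in> all.symbols"
  by (simp add: all.symbols_def coeff_symb jets_dd)

lemma symb_xfree_symbols: "h \<in> jets \<Longrightarrow> dd Jx h = 0 \<Longrightarrow> symb h \<in> xfree.symbols"
  unfolding xfree.symbols_def by (auto simp: coeff_symb jets_x_def jets_dd dd_swap[of h Jx] dd_0)

context
  fixes n :: nat and F :: jet_fun
  assumes n: "n \<ge> 2"
    and F: "F \<in> jets" "dd Jx F = 0" "dd Jt F = 0"
    and F_order: "\<And>s. s > n \<Longrightarrow> dd (Ju s) F = 0"
    and F_separant: "dd (Ju n) F = const_on 1"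
begin

text \<open>
  Off \<open>M\<close> the separant \<open>dd (Ju n) F\<close> is \<open>0\<close> instead of \<open>1\<close>; the correction makes the symbol monic
  without changing its commutators with linearizations, whose coefficients vanish off \<open>M\<close>.
\<close>

definition monic_symb :: "jet_fun poly" where
  "monic_symb = symb F + monom (1 - const_on 1) n"

lemma correction: "1 - const_on 1 \<in> jets_x" "DD (1 - const_on 1) = 0" "dd v (1 - const_on 1) = 0"
proof -
  show *: "dd v (1 - const_on 1) = 0" for v
    by (simp add: dd_diff jets_1 jets_const_on dd_const_on dd_const[of _ 1, folded one_fun_def])
  show "1 - const_on 1 \<in> jets_x"
    using * by (simp add: jets_x_def jets_diff jets_1 jets_const_on)
  show "DD (1 - const_on 1) = 0"
    using DD_eq_dd_Jx[OF *] * by simp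
qed

text \<open>The two factors have disjoint supports: \<open>dd v h\<close> vanishes off
  \<open>M\<close> and the correction vanishes on \<open>M\<close>.\<close>

lemma correction_mult_dd: "dd v h * (1 - const_on 1) = 0"
  by (simp add: right_diff_distrib const_on_1_dd mult.commute)

lemma act_correction_left:
  assumes "h \<in> jets"
  shows "all.act (monom (1 - const_on 1) n) (symb h) = 0"
proof -
  have "all.act (monom (1 - const_on 1) n) (symb h) = smult (1 - const_on 1) (symb ((DD ^^ n) h))"
    unfolding all.act_eq[OF degree_monom_le] using assms
    by (simp add: shift_pow_symb if_distrib[of "\<lambda>c. smult c _"] cong: if_cong)
  also have "\<dots> = 0"
    using assms
    by (intro poly_eqI) (simp add: coeff_symb jets_DD_pow mult.commute[of "1 - const_on 1"] correction_mult_dd)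
  finally show ?thesis .
qed

lemma act_correction_right:
  assumes "h \<in> jets"
  shows "all.act (symb h) (monom (1 - const_on 1) n) = 0"
proof -
  have c: "1 - const_on 1 \<in> jets" using correction(1) by (simp add: jets_x_def)
  have "monom 1 n \<in> all.symbols"
    by (auto simp: all.symbols_def jets_0 jets_1)
  then have "all.act (symb h) (smult (1 - const_on 1) (monom 1 n))
      = smult (1 - const_on 1) (all.act (symb h) (monom 1 n))"
    using all.act_smult_const_right[OF c correction(2)] by blast
  also have "\<dots> = all.act (smult (1 - const_on 1) (symb h)) (monom 1 n)"
    by (simp add: all.act_smult_left)
  also have "smult (1 - const_on 1) (symb h) = 0"
    using assms
    by (intro poly_eqI) (simp add: coeff_symb mult.commute[of "1 - const_on 1"] correction_mult_dd)
  finally show ?thesis by (simp only: smult_monom mult_1_right all.act_0_left)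
qed

lemma commutator_monic_symb:
  assumes "G \<in> jets"
  shows "all.commutator monic_symb (symb G) = all.commutator (symb F) (symb G)"
proof -
  have "monom (1 - const_on 1) n \<in> all.symbols"
    using correction(1) by (auto simp: all.symbols_def jets_0 jets_x_def)
  then show ?thesis
    using assms F(1)
    by (simp add: all.commutator_def monic_symb_def all.act_add_left all.act_add_right
        symb_symbols act_correction_left act_correction_right)
qed

lemma monic_symb_monic: "degree monic_symb \<le> n" "coeff monic_symb n = 1"
  and monic_symb_symbols: "monic_symb \<in> xfree.symbols"
proof -
  show "degree monic_symb \<le> n"
    unfolding monic_symb_def
    by (intro degree_add_le degree_symb_le degree_monom_le F(1) F_order)
  show "coeff monic_symb n = 1"
    by (simp add: monic_symb_def coeff_symb F F_separant)
  show "monic_symb \<in> xfree.symbols"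
    unfolding monic_symb_def using F correction(1)
    by (intro xfree.add_symbols symb_xfree_symbols) (auto simp: xfree.symbols_def xfree.K_0)
qed

text \<open>A coefficient of the linearized symmetry equation. From index \<open>n\<close> on, the
  derivatives of \<open>F\<close> are constant on \<open>M\<close>, so their linearization drops
  out.\<close>

lemma symmetry_coefficient:
  assumes "G \<in> symmetry_jets F" "n \<le> s"
  shows "coeff (all.commutator monic_symb (symb G)) s = dd Jt (dd (Ju s) G) + lin (dd (Ju s) G) F"
proof -
  have G: "G \<in> jets" "dd Jt G = brk F G" using assms(1) by (auto simp: symmetry_jets_def)
  have "lin (dd (Ju s) F) G = 0"
    using assms(2) F_order F_separant by (cases "s = n") (auto simp: lin_const_on_left lin_0_left simp del: zero_fun_apply)
  then show ?thesis
    using dd_Ju_brk[OF F(1) G(1), of s] G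
    by (simp add: commutator_monic_symb dd_swap[of G Jt])
qed

lemma leading_coefficient:
  assumes G: "G \<in> symmetry_jets F" and k: "n \<le> k" and ord: "\<And>s. s > k \<Longrightarrow> dd (Ju s) G = 0"
  shows "DD (dd (Ju k) G) = 0"
    and "dd Jx G = 0 \<Longrightarrow> dd Jt (dd (Ju k) G) = 0"
proof -
  have jets_G: "G \<in> jets" using G by (simp add: symmetry_jets_def)
  have deg: "degree (symb G) \<le> k"
    using degree_symb_le[OF jets_G ord] .
  have above: "coeff (all.commutator monic_symb (symb G)) s = 0" if "s > k" for s
    using symmetry_coefficient[OF G, of s] that k ord[OF that]
    by (simp add: lin_0_left dd_0)
  \<comment> \<open>The condition n >= 2 puts s = n + k - 1 strictly above k, where the commutator
    has no coefficient. By monicity that coefficient is n times \<open>D\<close> of the leading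
    one.\<close>
  obtain s where s: "n + k = Suc s" "s > k" using n by (cases n) auto
  have "of_nat n * DD (dd (Ju k) G) = 0"
    using all.coeff_commutator_monic(1)[OF monic_symb_monic deg] above[OF s(2)] jets_G
    by (simp add: s(1) coeff_symb)
  then have "of_nat n * DD (dd (Ju k) G) p = 0" for p
    by (metis times_fun_apply of_nat_fun_apply zero_fun_apply)
  then show DD_lead: "DD (dd (Ju k) G) = 0"
    using n by (auto simp: fun_eq_iff)
  assume x: "dd Jx G = 0"
  have "lin (dd (Ju k) G) F = 0"
    using DD_eq_0_imp(1)[OF jets_dd[OF jets_G] DD_lead] by (simp add: lin_def)
  then have top: "coeff (all.commutator monic_symb (symb G)) k = dd Jt (dd (Ju k) G)"
    using symmetry_coefficient[OF G k] by simp
  \<comment> \<open>The commutator is the same under both interpretations; passing to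
    \<open>xfree\<close> supplies \<open>DD_DD_eq_0\<close>. The top coefficient at k is the
    t-derivative of the leading one, which is again constant since \<open>Jt\<close> commutes with
    \<open>DD\<close>.\<close>
  have "coeff (xfree.commutator monic_symb (symb G)) k = 0"
  proof (rule xfree.commutator_monic_top_coeff_eq_0[OF _ _ _ _ monic_symb_symbols monic_symb_monic])
    show "x = 0" if "of_nat j * x = 0" "j > 0" for j and x :: jet_fun
      using that by (auto simp: fun_eq_iff)
    show "x = 0" if "x ^ j = 0" for j and x :: jet_fun
    proof
      fix p
      have "(x p) ^ j = 0" using that by (metis power_fun_apply zero_fun_apply)
      then show "x p = 0 p" by simp
    qed
    show "symb G \<in> xfree.symbols" using symb_xfree_symbols[OF jets_G x] .
    show "degree (all.commutator monic_symb (symb G)) \<le> k"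
      using above by (intro degree_le) simp
    show "DD (coeff (all.commutator monic_symb (symb G)) k) = 0"
      using dd_DD[OF jets_dd[OF jets_G], of Jt "Ju k"] DD_lead by (simp add: top dd_0)
    show "0 < n" using n by simp
  qed (use DD_DD_eq_0 in auto)
  then show "dd Jt (dd (Ju k) G) = 0" by (simp add: top)
qed

lemma symmetry_annihilated:
  assumes "0 \<in> \<Lambda>"
    and low: "\<And>G. G \<in> symmetry_jets F \<Longrightarrow> (\<And>s. s \<ge> n \<Longrightarrow> dd (Ju s) G = 0) \<Longrightarrow> annihilated \<Lambda> G"
    and G: "G \<in> symmetry_jets F"
  shows "annihilated \<Lambda> G"
proof -
  \<comment> \<open>Induction on a strict order bound: at \<open>Suc k\<close> the possible leading
    coefficient is the derivative in \<open>Ju k\<close>.\<close>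
  have "annihilated \<Lambda> G" if "G \<in> symmetry_jets F" "\<And>s. s \<ge> k \<Longrightarrow> dd (Ju s) G = 0" for k G
    using that
  proof (induction k arbitrary: G)
    case 0
    then show ?case using low by blast
  next
    case (Suc k)
    show ?case
    proof (cases "n \<le> k")
      case False
      then have "dd (Ju s) G = 0" if "n \<le> s" for s
        by (intro Suc.prems(2)) (use that in simp)
      then show ?thesis using low Suc.prems(1) by blast
    next
      case True
      have G: "G \<in> jets" using Suc.prems by (simp add: symmetry_jets_def)
      have "DD (dd (Ju k) G) = 0"
        by (rule leading_coefficient(1)[OF Suc.prems(1) True], rule Suc.prems(2)) simp
      then have x: "dd Jx (dd (Ju k) G) = 0"
        by (rule DD_eq_0_imp(2)[OF jets_dd[OF G]])
      have "annihilated \<Lambda> (dd Jx G)"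
      proof (rule Suc.IH)
        show "dd Jx G \<in> symmetry_jets F" using symmetry_jets_dd[OF F(1) _ F(2) Suc.prems(1)] by simp
        show "dd (Ju s) (dd Jx G) = 0" if "s \<ge> k" for s
          using x Suc.prems(2)[of s] that
          by (cases "s = k") (auto simp: dd_swap[OF G, of _ Jx] dd_0 simp del: zero_fun_apply)
      qed
      then obtain cs where cs: "set cs \<subseteq> \<Lambda>" "foldr time_op cs (dd Jx G) = 0"
        by (auto simp: annihilated_def)
      define G1 where "G1 = foldr time_op cs G"
      have G1: "G1 \<in> symmetry_jets F"
        unfolding G1_def by (rule symmetry_jets_foldr_time_op[OF F(1,3) Suc.prems(1)])
      then have jets_G1: "G1 \<in> jets" by (simp add: symmetry_jets_def)
      have order_G1: "dd (Ju s) G1 = 0" if "s > k" for s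
        using Suc.prems(2)[of s] that G
        by (simp add: G1_def dd_foldr_time_op foldr_time_op_zero del: zero_fun_apply)
      have "dd Jx G1 = 0" using cs(2) G by (simp add: G1_def dd_foldr_time_op)
      then have t: "dd Jt (dd (Ju k) G1) = 0"
        by (intro leading_coefficient(2)[OF G1 True] order_G1)
      have "annihilated \<Lambda> (time_op 0 G1)"
      proof (rule Suc.IH)
        show "time_op 0 G1 \<in> symmetry_jets F" by (rule symmetry_jets_time_op[OF F(1,3) G1])
        show "dd (Ju s) (time_op 0 G1) = 0" if "s \<ge> k" for s
          using t order_G1[of s] that
          by (cases "s = k")
            (auto simp: time_op_0_eq dd_swap[OF jets_G1, of _ Jt] dd_0 simp del: zero_fun_apply)
      qed
      then obtain ds where "set ds \<subseteq> \<Lambda>" "foldr time_op ds (time_op 0 G1) = 0"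
        by (auto simp: annihilated_def)
      with cs show ?thesis
        unfolding annihilated_def using assms(1)
        \<comment> \<open>\<open>foldr\<close> applies the right end first: \<open>cs\<close>
          removes x, the factor \<open>0\<close> is the t-derivative lowering the order, and
          \<open>ds\<close> comes from the second use of the induction hypothesis.\<close>
        by (intro exI[of _ "ds @ 0 # cs"]) (simp add: G1_def)
    qed
  qed
  moreover obtain N where "order_below N G"
    using order_below_exists[of G] G by (auto simp: symmetry_jets_def)
  ultimately show ?thesis using G by (auto simp: order_below_def)
qed

end

end

section \<open>Quasipolynomials in time\<close>

context jet_open
begin

definition exp_t :: "complex \<Rightarrow> jet_fun" where
  "exp_t \<mu> = (\<lambda>p. exp (\<mu> * of_real (p Jt)))"

definition quasi_term :: "jet_fun \<Rightarrow> nat \<Rightarrow> complex \<Rightarrow> jet_fun" where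
  "quasi_term c d \<mu> = c * coord Jt ^ d * exp_t \<mu>"

inductive_set quasi_span :: "complex set \<Rightarrow> jet_fun set" for \<Lambda> where
  zero: "0 \<in> quasi_span \<Lambda>"
| add: "g \<in> quasi_span \<Lambda> \<Longrightarrow> h \<in> quasi_span \<Lambda> \<Longrightarrow> g + h \<in> quasi_span \<Lambda>"
| quasi_term: "time_coefficient M c \<Longrightarrow> \<mu> \<in> \<Lambda> \<Longrightarrow> quasi_term c d \<mu> \<in> quasi_span \<Lambda>"

lemma quasi_term_apply: "quasi_term c d \<mu> p = c p * of_real (p Jt) ^ d * exp (\<mu> * of_real (p Jt))"
  by (simp add: quasi_term_def coord_def exp_t_def power_fun_apply)

lemma const_on_0: "const_on 0 = 0"
  by (rule ext) (simp add: const_on_def)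

lemma jets_exp_t: "exp_t \<mu> \<in> jets"
  by (simp add: jets_def exp_t_def jet_function_exp)

lemma dd_exp_t: "dd Jt (exp_t \<mu>) = const_on \<mu> * exp_t \<mu>"
  using pd_exp[of Jt 1 \<mu>] by (auto simp: dd_def exp_t_def const_on_def fun_eq_iff)

lemma jets_power: "h \<in> jets \<Longrightarrow> h ^ d \<in> jets"
  by (rule all.K_power)

lemma dd_coord_power: "dd Jt (coord Jt ^ d) = const_on (of_nat d) * coord Jt ^ (d - 1)"
proof (induction d)
  case 0
  show ?case
    using dd_const[of Jt 1] const_on_0 by (simp add: one_fun_def zero_fun_def)
next
  case (Suc d)
  have "dd Jt (coord Jt ^ Suc d) = const_on 1 * coord Jt ^ d + coord Jt * (const_on (of_nat d) * coord Jt ^ (d - 1))"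
    unfolding power_Suc dd_mult[OF jets_coord jets_power[OF jets_coord]] Suc dd_coord by simp
  also have "\<dots> = const_on (of_nat (Suc d)) * coord Jt ^ (Suc d - 1)"
    by (rule ext, cases d) (simp_all add: const_on_def algebra_simps)
  finally show ?case .
qed

lemma time_coefficientD:
  assumes "time_coefficient M c"
  shows "c \<in> jets" "dd Jt c = 0"
proof -
  show "c \<in> jets" using assms by (simp add: time_coefficient_def jets_def)
  show "dd Jt c = 0"
    using assms pd_eq_0_if_depends_only[of "- {Jt}" c Jt]
    by (auto simp: time_coefficient_def dd_def fun_eq_iff)
qed

lemma time_coefficient_mult_const:
  "time_coefficient M c \<Longrightarrow> time_coefficient M (\<lambda>p. a * c p)"
  using jet_function_mult[OF jet_function_const[of a], of c]
  unfolding time_coefficient_def depends_only_def times_fun_def by metis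

lemma time_coefficient_add:
  "time_coefficient M c \<Longrightarrow> time_coefficient M d \<Longrightarrow> time_coefficient M (\<lambda>p. c p + d p)"
  using jet_function_add[of c d]
  unfolding time_coefficient_def depends_only_def plus_fun_def by metis

lemma time_coefficient_0: "time_coefficient M (\<lambda>p. 0)"
  using jet_function_const[of 0] by (simp add: time_coefficient_def depends_only_def)

lemma jets_quasi_term: "time_coefficient M c \<Longrightarrow> quasi_term c d \<mu> \<in> jets"
  by (simp add: quasi_term_def jets_mult jets_power jets_coord jets_exp_t time_coefficientD)

lemma jets_quasi_span: "g \<in> quasi_span \<Lambda> \<Longrightarrow> g \<in> jets"
  by (induction rule: quasi_span.induct) (rule jets_0, rule jets_add, assumption+, rule jets_quasi_term)

lemma quasi_span_sum: "(\<And>i. i \<in> S \<Longrightarrow> h i \<in> quasi_span \<Lambda>) \<Longrightarrow> sum h S \<in> quasi_span \<Lambda>"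
  by (induction S rule: infinite_finite_induct) (auto intro: quasi_span.zero quasi_span.add)

text \<open>This formula drives both directions: at \<nu> = \<mu> the degree falls, and otherwise
  the top coefficient is multiplied by a nonzero number. For d = 0 the truncated
  \<open>d - 1\<close> is harmless, as its factor is zero.\<close>

lemma time_op_quasi_term:
  assumes "time_coefficient M c"
  shows "time_op \<nu> (quasi_term c d \<mu>) = const_on (of_nat d) * quasi_term c (d - 1) \<mu> + const_on (\<mu> - \<nu>) * quasi_term c d \<mu>"
proof -
  have "dd Jt (quasi_term c d \<mu>) = c * (const_on (of_nat d) * coord Jt ^ (d - 1)) * exp_t \<mu> + c * coord Jt ^ d * (const_on \<mu> * exp_t \<mu>)"
    using time_coefficientD[OF assms]
    by (simp add: quasi_term_def dd_mult jets_mult jets_power jets_coord jets_exp_t dd_coord_power dd_exp_t)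
  then show ?thesis
    by (intro ext) (simp add: time_op_def quasi_term_def const_on_def algebra_simps)
qed

section \<open>Products of time operators and their kernels\<close>

lemma time_op_add: "g \<in> jets \<Longrightarrow> h \<in> jets \<Longrightarrow> time_op c (g + h) = time_op c g + time_op c h"
  by (simp add: time_op_def dd_add algebra_simps)

lemma time_op_diff: "g \<in> jets \<Longrightarrow> h \<in> jets \<Longrightarrow> time_op c (g - h) = time_op c g - time_op c h"
  by (simp add: time_op_def dd_diff algebra_simps)

lemma time_op_const_on_mult: "h \<in> jets \<Longrightarrow> time_op a (const_on c * h) = const_on c * time_op a h"
  by (simp add: time_op_def dd_const_on_mult right_diff_distrib mult.left_commute)

lemma time_op_cong:
  assumes "\<And>p. p \<in> M \<Longrightarrow> g p = h p"
  shows "time_op c g = time_op c h"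
proof
  fix p
  show "time_op c g p = time_op c h p"
    using assms dd_cong[of g h Jt] by (simp add: time_op_def const_on_def)
qed

lemma time_op_commute: "h \<in> jets \<Longrightarrow> time_op a (time_op b h) = time_op b (time_op a h)"
proof -
  assume h: "h \<in> jets"
  have "dd Jt (dd Jt h - const_on c * h) = dd Jt (dd Jt h) - const_on c * dd Jt h" for c
    using h by (simp add: dd_diff dd_const_on_mult jets_dd jets_mult jets_const_on)
  then show ?thesis
    by (simp add: time_op_def) (simp add: algebra_simps)
qed

lemma time_op_foldr_time_op: "h \<in> jets \<Longrightarrow> time_op a (foldr time_op cs h) = foldr time_op cs (time_op a h)"
  by (induction cs) (auto simp: time_op_commute[of _ a] jets_foldr_time_op)

lemma foldr_time_op_commute: "h \<in> jets \<Longrightarrow> foldr time_op cs (foldr time_op ds h) = foldr time_op ds (foldr time_op cs h)"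
  by (induction cs) (auto simp: time_op_foldr_time_op jets_foldr_time_op)

lemma foldr_time_op_add:
  "g \<in> jets \<Longrightarrow> h \<in> jets \<Longrightarrow> foldr time_op cs (g + h) = foldr time_op cs g + foldr time_op cs h"
  by (induction cs) (auto simp: time_op_add jets_foldr_time_op)

lemma foldr_time_op_const_on_mult: "h \<in> jets \<Longrightarrow> foldr time_op cs (const_on c * h) = const_on c * foldr time_op cs h"
  by (induction cs) (auto simp: time_op_const_on_mult jets_foldr_time_op)

text \<open>The factors commute, so in the concatenated product each summand can meet its own
  annihilator first.\<close>

lemma annihilated_add:
  assumes "g \<in> jets" "h \<in> jets" "annihilated \<Lambda> g" "annihilated \<Lambda> h"
  shows "annihilated \<Lambda> (g + h)"
proof -
  obtain cs ds where cs: "set cs \<subseteq> \<Lambda>" "foldr time_op cs g = 0" and ds: "set ds \<subseteq> \<Lambda>" "foldr time_op ds h = 0"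
    using assms by (auto simp: annihilated_def)
  have "foldr time_op (cs @ ds) (g + h) = foldr time_op ds (foldr time_op cs g) + foldr time_op cs (foldr time_op ds h)"
    using assms by (simp add: foldr_time_op_add jets_foldr_time_op foldr_time_op_commute[of g])
  also have "\<dots> = 0"
    unfolding cs ds foldr_time_op_zero by simp
  finally show ?thesis
    using cs(1) ds(1) unfolding annihilated_def by (intro exI[of _ "cs @ ds"]) simp
qed

lemma foldr_time_op_quasi_term:
  assumes "time_coefficient M c"
  shows "foldr time_op (replicate (Suc d) \<mu>) (quasi_term c d \<mu>) = 0"
proof (induction d)
  case 0
  show ?case using time_op_quasi_term[OF assms, of \<mu> 0 \<mu>] by (auto simp: const_on_def fun_eq_iff)
next
  case (Suc d)
  have time_op: "time_op \<mu> (quasi_term c (Suc d) \<mu>) = const_on (of_nat (Suc d)) * quasi_term c d \<mu>"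
    using time_op_quasi_term[OF assms, of \<mu> "Suc d" \<mu>] by (auto simp: const_on_def fun_eq_iff)
  have "foldr time_op (replicate (Suc (Suc d)) \<mu>) (quasi_term c (Suc d) \<mu>)
      = foldr time_op (replicate (Suc d) \<mu>) (time_op \<mu> (quasi_term c (Suc d) \<mu>))"
  proof -
    have "replicate (Suc (Suc d)) \<mu> = replicate (Suc d) \<mu> @ [\<mu>]"
      by (metis replicate_append_same replicate_Suc)
    then show ?thesis by (simp only: foldr_append foldr.simps comp_apply id_apply)
  qed
  also have "\<dots> = const_on (of_nat (Suc d)) * foldr time_op (replicate (Suc d) \<mu>) (quasi_term c d \<mu>)"
    unfolding time_op by (rule foldr_time_op_const_on_mult[OF jets_quasi_term[OF assms]])
  finally show ?case unfolding Suc by simp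
qed

lemma quasi_span_annihilated: "g \<in> quasi_span \<Lambda> \<Longrightarrow> annihilated \<Lambda> g"
proof (induction rule: quasi_span.induct)
  case zero
  show ?case unfolding annihilated_def by (intro exI[of _ "[]"]) simp
next
  case (add g h)
  then show ?case by (intro annihilated_add jets_quasi_span)
next
  case (quasi_term c \<mu> d)
  then show ?case
    unfolding annihilated_def
    by (intro exI[of _ "replicate (Suc d) \<mu>"] conjI foldr_time_op_quasi_term) auto
qed

text \<open>A list killing \<open>g\<close> need not kill \<open>h\<close> off \<open>M\<close>: an
  empty list tests the function everywhere. One further factor \<open>0\<close>, a truncated
  t-derivative, erases the values off \<open>M\<close>.\<close>

lemma annihilated_cong:
  assumes "annihilated \<Lambda> g" "0 \<in> \<Lambda>" "\<And>p. p \<in> M \<Longrightarrow> g p = h p"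
  shows "annihilated \<Lambda> h"
proof -
  obtain cs where cs: "set cs \<subseteq> \<Lambda>" "foldr time_op cs g = 0"
    using assms by (auto simp: annihilated_def)
  have "foldr time_op cs g p = foldr time_op cs h p" if "p \<in> M" for p
    using that assms(3) by (induction cs arbitrary: p) (auto intro: fun_cong[OF time_op_cong])
  then have "foldr time_op (0 # cs) g = foldr time_op (0 # cs) h"
    by (simp add: time_op_cong[of "foldr time_op cs g"])
  moreover have "foldr time_op (0 # cs) g = 0"
    using cs(2) by (simp add: time_op_zero del: zero_fun_apply)
  ultimately show ?thesis
    unfolding annihilated_def using cs(1) assms(2) by (intro exI[of _ "0 # cs"]) auto
qed

text \<open>In the resonant case \<mu> = \<nu> the degree is raised by one. Otherwise undetermined
  coefficients work by induction on the degree.\<close>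

lemma quasi_term_antiderivative:
  assumes "time_coefficient M c" "\<mu> \<in> \<Lambda>"
  shows "\<exists>g\<in>quasi_span \<Lambda>. \<forall>p\<in>M. time_op \<nu> g p = quasi_term c d \<mu> p"
proof (cases "\<mu> = \<nu>")
  case True
  define b where "b = (\<lambda>p. (1 / of_nat (Suc d)) * c p)"
  have b: "time_coefficient M b"
    unfolding b_def by (rule time_coefficient_mult_const[OF assms(1)])
  show ?thesis
  proof (intro bexI ballI)
    show "quasi_term b (Suc d) \<mu> \<in> quasi_span \<Lambda>" by (rule quasi_span.quasi_term[OF b assms(2)])
    show "time_op \<nu> (quasi_term b (Suc d) \<mu>) p = quasi_term c d \<mu> p" if "p \<in> M" for p
      unfolding time_op_quasi_term[OF b] using that by (simp add: True const_on_def quasi_term_apply b_def del: of_nat_Suc)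
  qed
next
  case False
  then obtain \<kappa> where \<kappa>: "(\<mu> - \<nu>) * \<kappa> = 1"
    by (metis right_inverse right_minus_eq)
  show ?thesis
    using assms(1)
  proof (induction d arbitrary: c)
    case 0
    define b where "b = (\<lambda>p. \<kappa> * c p)"
    have b: "time_coefficient M b"
      unfolding b_def by (rule time_coefficient_mult_const[OF 0])
    show ?case
    proof (intro bexI ballI)
      show "quasi_term b 0 \<mu> \<in> quasi_span \<Lambda>" by (rule quasi_span.quasi_term[OF b assms(2)])
      show "time_op \<nu> (quasi_term b 0 \<mu>) p = quasi_term c 0 \<mu> p" if "p \<in> M" for p
        unfolding time_op_quasi_term[OF b] using that \<kappa> by (simp add: const_on_def quasi_term_apply b_def flip: mult.assoc)
    qed
  next
    case (Suc d)
    \<comment> \<open>\<open>b\<close> matches the top power of t; differentiating that power leaves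
      a term of degree \<open>d\<close>, and \<open>a\<close> is chosen so that \<open>g\<close>
      cancels it.\<close>
    define b where "b = (\<lambda>p. \<kappa> * c p)"
    define a where "a = (\<lambda>p. (- of_nat (Suc d) * \<kappa>) * c p)"
    have b: "time_coefficient M b" and a: "time_coefficient M a"
      unfolding b_def a_def by (rule time_coefficient_mult_const[OF Suc.prems])+
    obtain g where g: "g \<in> quasi_span \<Lambda>" "\<forall>p\<in>M. time_op \<nu> g p = quasi_term a d \<mu> p"
      using Suc.IH[OF a] by blast
    show ?case
    proof (intro bexI ballI)
      show "quasi_term b (Suc d) \<mu> + g \<in> quasi_span \<Lambda>" by (intro quasi_span.add quasi_span.quasi_term b g assms(2))
      fix p assume p: "p \<in> M"
      have "time_op \<nu> (quasi_term b (Suc d) \<mu> + g) p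
          = of_nat (Suc d) * quasi_term b d \<mu> p + (\<mu> - \<nu>) * quasi_term b (Suc d) \<mu> p + quasi_term a d \<mu> p"
        unfolding time_op_add[OF jets_quasi_term[OF b] jets_quasi_span[OF g(1)]] time_op_quasi_term[OF b]
        using p g by (simp add: const_on_def del: of_nat_Suc)
      also have "\<dots> = ((\<mu> - \<nu>) * \<kappa>) * quasi_term c (Suc d) \<mu> p"
        by (simp add: quasi_term_apply a_def b_def algebra_simps del: of_nat_Suc)
      finally show "time_op \<nu> (quasi_term b (Suc d) \<mu> + g) p = quasi_term c (Suc d) \<mu> p"
        by (simp add: \<kappa>)
    qed
  qed
qed

lemma quasi_span_antiderivative:
  "h \<in> quasi_span \<Lambda> \<Longrightarrow> \<exists>g\<in>quasi_span \<Lambda>. \<forall>p\<in>M. time_op \<nu> g p = h p"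
proof (induction rule: quasi_span.induct)
  case zero
  show ?case by (rule bexI[OF _ quasi_span.zero]) (unfold time_op_zero, blast)
next
  case (add g h)
  then obtain a b where ab: "a \<in> quasi_span \<Lambda>" "b \<in> quasi_span \<Lambda>"
    "\<forall>p\<in>M. time_op \<nu> a p = g p" "\<forall>p\<in>M. time_op \<nu> b p = h p" by blast
  show ?case
  proof (intro bexI ballI)
    show "a + b \<in> quasi_span \<Lambda>" by (intro quasi_span.add ab)
    show "time_op \<nu> (a + b) p = (g + h) p" if "p \<in> M" for p
      unfolding time_op_add[OF ab(1,2)[THEN jets_quasi_span]] using that ab by simp
  qed
qed (rule quasi_term_antiderivative)

text \<open>Factors are peeled off from the right end of the list, the one applied to
  \<open>G\<close> first. Subtracting a quasipolynomial solution \<open>g\<close> leaves a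
  \<open>K\<close> with \<open>time_op c K\<close> zero on \<open>M\<close>. Multiplying
  \<open>K\<close> by exp(-ct) removes its t-dependence, by the hypothesis
  \<open>time\<close>.\<close>

lemma annihilated_imp_quasi_span:
  assumes time: "\<And>c. c \<in> jets \<Longrightarrow> dd Jt c = 0 \<Longrightarrow> time_coefficient M c"
    and "G \<in> jets" "annihilated \<Lambda> G"
  shows "\<exists>g\<in>quasi_span \<Lambda>. \<forall>p\<in>M. G p = g p"
proof -
  obtain cs where "set cs \<subseteq> \<Lambda>" "foldr time_op cs G = 0"
    using assms by (auto simp: annihilated_def)
  then show ?thesis
    using assms(2)
  proof (induction cs arbitrary: G rule: rev_induct)
    case Nil
    then show ?case by (intro bexI[OF _ quasi_span.zero]) simp
  next
    case (snoc c cs)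
    have cs: "set cs \<subseteq> \<Lambda>" "foldr time_op cs (time_op c G) = 0"
      using snoc.prems(1,2) by (auto simp del: zero_fun_apply)
    obtain h where h: "h \<in> quasi_span \<Lambda>" "\<forall>p\<in>M. time_op c G p = h p"
      using snoc.IH[OF cs jets_time_op[OF snoc.prems(3)]] by blast
    then obtain g where g: "g \<in> quasi_span \<Lambda>" "\<forall>p\<in>M. time_op c g p = h p"
      using quasi_span_antiderivative by blast
    define K where "K = G - g"
    have K: "K \<in> jets" using snoc.prems g by (simp add: K_def jets_diff jets_quasi_span)
    define b where "b = K * exp_t (- c)"
    have time_op_K: "time_op c K p = 0" if "p \<in> M" for p
      using that h g snoc.prems by (simp add: K_def time_op_diff jets_quasi_span)
    have "dd Jt b = 0"
    proof
      fix p
      show "dd Jt b p = 0 p"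
      proof (cases "p \<in> M")
        case True
        have "dd Jt b p = time_op c K p * exp_t (- c) p"
          using True by (simp add: b_def dd_mult K jets_exp_t dd_exp_t time_op_def const_on_def algebra_simps)
        then show ?thesis using time_op_K[OF True] by simp
      qed (simp add: dd_def)
    qed
    then have b: "time_coefficient M b"
      using time[of b] K by (simp add: b_def jets_mult jets_exp_t)
    show ?case
    proof (intro bexI ballI)
      show "g + quasi_term b 0 c \<in> quasi_span \<Lambda>"
        using g(1) b snoc.prems(1) by (intro quasi_span.add quasi_span.quasi_term) auto
      show "G p = (g + quasi_term b 0 c) p" for p
        by (simp add: quasi_term_apply b_def exp_t_def K_def mult.assoc flip: exp_add)
    qed
  qed
qed

lemma polynomial_in_t_iff: "polynomial_in_t M G \<longleftrightarrow> (\<exists>g\<in>quasi_span {0}. \<forall>p\<in>M. G p = g p)"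
proof
  assume "polynomial_in_t M G"
  then obtain d c where c: "\<forall>j\<le>(d::nat). time_coefficient M (c j)"
    "\<forall>p\<in>M. G p = (\<Sum>j\<le>d. c j p * of_real (p Jt) ^ j)"
    unfolding polynomial_in_t_def by blast
  then show "\<exists>g\<in>quasi_span {0}. \<forall>p\<in>M. G p = g p"
    by (intro bexI[of _ "\<Sum>j\<le>d. quasi_term (c j) j 0"])
      (auto simp: sum_fun_apply quasi_term_apply intro!: quasi_span_sum quasi_span.quasi_term)
next
  have "polynomial_in_t M g" if "g \<in> quasi_span {0}" for g
    using that
  proof induction
    case zero
    show ?case
      unfolding polynomial_in_t_def
      by (intro exI[of _ 0] exI[of _ "\<lambda>j p. 0"]) (simp add: time_coefficient_0)
  next
    case (add g h)
    obtain d c where c: "\<forall>j\<le>(d::nat). time_coefficient M (c j)"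
      "\<forall>p\<in>M. g p = (\<Sum>j\<le>d. c j p * of_real (p Jt) ^ j)"
      using add.IH(1) unfolding polynomial_in_t_def by blast
    obtain e b where b: "\<forall>j\<le>(e::nat). time_coefficient M (b j)"
      "\<forall>p\<in>M. h p = (\<Sum>j\<le>e. b j p * of_real (p Jt) ^ j)"
      using add.IH(2) unfolding polynomial_in_t_def by blast
    \<comment> \<open>Extends a coefficient family by zero, so that two polynomials of different
      degrees are summed over a common range.\<close>
    define cut where "cut d c j = (if j \<le> d then c j else (\<lambda>p. 0))"
      for d j :: nat and c :: "nat \<Rightarrow> jet_fun"
    have cut: "(\<Sum>j\<le>k. c j p * x ^ j) = (\<Sum>j\<le>max d e. cut k c j p * x ^ j)"
      if "k \<le> max d e" for k c p x
      using that by (intro sum.mono_neutral_cong_left) (auto simp: cut_def)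
    show ?case
      unfolding polynomial_in_t_def
    proof (intro exI[of _ "max d e"] exI[of _ "\<lambda>j p. cut d c j p + cut e b j p"] conjI allI impI ballI)
      show "time_coefficient M (\<lambda>p. cut d c j p + cut e b j p)" for j
        using b c by (intro time_coefficient_add) (auto simp: cut_def time_coefficient_0)
      show "(g + h) p = (\<Sum>j\<le>max d e. (cut d c j p + cut e b j p) * of_real (p Jt) ^ j)"
        if "p \<in> M" for p
        using that b c by (simp add: cut algebra_simps sum.distrib)
    qed
  next
    case (quasi_term c \<mu> d)
    show ?case
      unfolding polynomial_in_t_def
    proof (intro exI[of _ d] exI[of _ "\<lambda>j. if j = d then c else (\<lambda>p. 0)"] conjI allI impI ballI)
      show "quasi_term c d \<mu> p = (\<Sum>j\<le>d. (if j = d then c else (\<lambda>p. 0)) p * of_real (p Jt) ^ j)" for p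
        using quasi_term by (simp add: quasi_term_apply if_distrib[of "\<lambda>f. f p * _"] cong: if_cong)
    qed (use quasi_term in \<open>auto simp: time_coefficient_0\<close>)
  qed
  moreover assume "\<exists>g\<in>quasi_span {0}. \<forall>p\<in>M. G p = g p"
  then obtain g where "g \<in> quasi_span {0}" "\<forall>p\<in>M. G p = g p" by blast
  ultimately show "polynomial_in_t M G"
    unfolding polynomial_in_t_def by simp
qed

lemma quasipolynomial_combination_in_t_iff:
  "quasipolynomial_combination_in_t M G \<longleftrightarrow> (\<exists>g\<in>quasi_span UNIV. \<forall>p\<in>M. G p = g p)"
proof
  assume "quasipolynomial_combination_in_t M G"
  then obtain m c q where c: "\<And>j. j < (m::nat) \<Longrightarrow> time_coefficient M (c j)"
    and q: "\<And>j. j < m \<Longrightarrow> quasipolynomial (q j)"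
    and G: "\<forall>p\<in>M. G p = (\<Sum>j<m. c j p * q j (p Jt))"
    unfolding quasipolynomial_combination_in_t_def by blast
  have "\<exists>g\<in>quasi_span UNIV. \<forall>p. c j p * q j (p Jt) = g p" if j: "j < m" for j
  proof -
    obtain \<mu> P where P: "\<forall>t. q j t = exp (\<mu> * of_real t) * poly P (of_real t)"
      using q[OF j] unfolding quasipolynomial_def by blast
    show ?thesis
    proof (intro bexI allI)
      show "(\<Sum>i\<le>degree P. quasi_term (\<lambda>p. coeff P i * c j p) i \<mu>) \<in> quasi_span UNIV"
        by (intro quasi_span_sum quasi_span.quasi_term time_coefficient_mult_const c j UNIV_I)
      show "c j p * q j (p Jt) = (\<Sum>i\<le>degree P. quasi_term (\<lambda>p. coeff P i * c j p) i \<mu>) p" for p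
        by (simp add: P poly_altdef sum_fun_apply quasi_term_apply sum_distrib_left sum_distrib_right
            algebra_simps)
    qed
  qed
  then obtain g where "\<And>j. j < m \<Longrightarrow> g j \<in> quasi_span UNIV"
    "\<And>j p. j < m \<Longrightarrow> c j p * q j (p Jt) = g j p" by metis
  with G show "\<exists>g\<in>quasi_span UNIV. \<forall>p\<in>M. G p = g p"
    by (intro bexI[of _ "\<Sum>j<m. g j"] quasi_span_sum) (auto simp: sum_fun_apply)
next
  have "quasipolynomial_combination_in_t M g" if "g \<in> quasi_span UNIV" for g
    using that
  proof induction
    case zero
    show ?case
      unfolding quasipolynomial_combination_in_t_def by (intro exI[of _ 0]) simp
  next
    case (add g h)
    obtain m c q where
      c: "\<forall>j<(m::nat). time_coefficient M (c j) \<and> quasipolynomial (q j)"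
        "\<forall>p\<in>M. g p = (\<Sum>j<m. c j p * q j (p Jt))"
      using add.IH(1) unfolding quasipolynomial_combination_in_t_def by blast
    obtain m' c' q' where
      c': "\<forall>j<(m'::nat). time_coefficient M (c' j) \<and> quasipolynomial (q' j)"
        "\<forall>p\<in>M. h p = (\<Sum>j<m'. c' j p * q' j (p Jt))"
      using add.IH(2) unfolding quasipolynomial_combination_in_t_def by blast
    \<comment> \<open>The two families are concatenated, the second one offset by
      \<open>m\<close>.\<close>
    define b where "b j = (if j < m then c j else c' (j - m))" for j
    define r where "r j = (if j < m then q j else q' (j - m))" for j
    have "(\<Sum>j<m + k. b j p * r j (p Jt))
        = (\<Sum>j<m. c j p * q j (p Jt)) + (\<Sum>j<k. c' j p * q' j (p Jt))" for k p
      by (induction k) (simp_all add: b_def r_def)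
    then show ?case
      unfolding quasipolynomial_combination_in_t_def using c c'
      by (intro exI[of _ "m + m'"] exI[of _ b] exI[of _ r]) (auto simp: b_def r_def)
  next
    case (quasi_term c \<mu> d)
    have "quasipolynomial (\<lambda>t. exp (\<mu> * of_real t) * poly (monom 1 d) (of_real t))"
      unfolding quasipolynomial_def by blast
    then show ?case
      unfolding quasipolynomial_combination_in_t_def using quasi_term
      by (intro exI[of _ 1] exI[of _ "\<lambda>j. c"]
          exI[of _ "\<lambda>j t. exp (\<mu> * of_real t) * poly (monom 1 d) (of_real t)"])
        (simp add: quasi_term_apply poly_monom)
  qed
  moreover assume "\<exists>g\<in>quasi_span UNIV. \<forall>p\<in>M. G p = g p"
  then obtain g where "g \<in> quasi_span UNIV" "\<forall>p\<in>M. G p = g p" by blast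
  ultimately show "quasipolynomial_combination_in_t M G"
    unfolding quasipolynomial_combination_in_t_def by simp
qed

text \<open>The bound makes \<open>GREATEST\<close> meaningful when some derivative is nonzero;
  otherwise \<open>jet_ord\<close> takes its default value 0.\<close>

lemma jet_ord_le:
  assumes "\<And>s. s > k \<Longrightarrow> dd (Ju s) G = 0"
  shows "jet_ord M G \<le> k"
proof (cases "\<exists>s. \<exists>p\<in>M. pd (Ju s) G p \<noteq> 0")
  case True
  have bound: "s \<le> k" if "\<exists>p\<in>M. pd (Ju s) G p \<noteq> 0" for s
    using that dd_eq_0D[OF assms] by (meson leI)
  have "\<exists>p\<in>M. pd (Ju (GREATEST s. \<exists>p\<in>M. pd (Ju s) G p \<noteq> 0)) G p \<noteq> 0"
    by (rule GreatestI_ex_nat[OF True bound])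
  then show ?thesis using bound True by (simp add: jet_ord_def)
qed (simp add: jet_ord_def)

end

section \<open>Product domains and conclusion\<close>

lemma open_jet_domain:
  assumes "open I" "open J" "open \<Omega>"
  shows "open (jet_domain I J \<Omega>)"
proof -
  have "continuous_on UNIV (\<lambda>p i. p (Ju i) :: real)"
    by (intro continuous_on_coordinatewise_then_product) simp
  then have "open ((\<lambda>p. p Jx) -` I)" "open ((\<lambda>p. p Jt) -` J)" "open ((\<lambda>p i. p (Ju i)) -` \<Omega>)"
    by (intro open_vimage assms; simp)+
  then have "open ((\<lambda>p. p Jx) -` I \<inter> (\<lambda>p. p Jt) -` J \<inter> (\<lambda>p i. p (Ju i)) -` \<Omega>)"
    by (intro open_Int)
  also have "(\<lambda>p. p Jx) -` I \<inter> (\<lambda>p. p Jt) -` J \<inter> (\<lambda>p i. p (Ju i)) -` \<Omega> = jet_domain I J \<Omega>"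
    by (auto simp: jet_domain_def)
  finally show ?thesis .
qed

text \<open>In a product domain the whole line of times from \<open>J\<close> through a point stays
  in \<open>M\<close>; along the connected \<open>J\<close> a zero derivative forces
  constancy.\<close>

lemma time_coefficient_jet_domain:
  assumes M: "M = jet_domain I J \<Omega>" "jet_open M" and J: "open J" "connected J"
    and c: "jet_function M c" "\<And>p. p \<in> M \<Longrightarrow> pd Jt c p = 0"
  shows "time_coefficient M c"
proof -
  interpret jet_open M by fact
  have "c p = c q" if p: "p \<in> M" and q: "q \<in> M" and eq: "\<forall>v\<in>- {Jt}. p v = q v" for p q
  proof -
    have upd: "p(Jt := s) \<in> M" if "s \<in> J" for s
      using p that by (simp add: M jet_domain_def)
    have q_eq: "q = p(Jt := q Jt)"
      using eq by (auto simp: fun_eq_iff)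
    have "c (p(Jt := p Jt)) = c (p(Jt := q Jt))"
    proof (rule has_derivative_zero_unique_connected[OF J])
      show "((\<lambda>s. c (p(Jt := s))) has_derivative (\<lambda>h. 0)) (at s)" if "s \<in> J" for s
        using has_pd_line[OF _ upd[OF that], of c] c upd[OF that]
        by (simp add: jet_function_def has_vector_derivative_def)
    qed (use p q in \<open>auto simp: M jet_domain_def\<close>)
    then show "c p = c q" by (simp flip: q_eq)
  qed
  with c(1) show ?thesis
    unfolding time_coefficient_def depends_only_def by blast
qed

theorem theorem3:
  fixes n :: nat and I J :: "real set" and \<Omega> :: "(nat \<Rightarrow> real) set"
    and M :: "jet_point set" and f F :: jet_fun
  assumes "n \<ge> 2"
    and "open I" "connected I" "open J" "connected J" "open \<Omega>" "connected \<Omega>"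
    and "M = jet_domain I J \<Omega>"
    and "jet_function M f" "depends_only M (Ju ` {..<n}) f"
    and "F = constant_separant_rhs n f"
  shows "((\<forall>G\<in>symmetries_upto M F (n - 1). polynomial_in_t M G) \<longrightarrow>
            (\<forall>G\<in>symmetries M F. polynomial_in_t M G)) \<and>
         ((\<forall>G\<in>symmetries_upto M F (n - 1). quasipolynomial_combination_in_t M G) \<longrightarrow>
            (\<forall>G\<in>symmetries M F. quasipolynomial_combination_in_t M G))"
proof -
  interpret jet_open M
    by unfold_locales (use open_jet_domain assms in blast)
  have time: "time_coefficient M c" if "c \<in> jets" "dd Jt c = 0" for c
    using time_coefficient_jet_domain[OF assms(8) jet_open_axioms assms(4,5), of c] that dd_eq_0D
    by (simp add: jets_def)
  have f: "f \<in> jets" using assms(9) by (simp add: jets_def)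
  have F_eq: "F = coord (Ju n) + f"
    unfolding assms(11) by (simp add: constant_separant_rhs_def coord_def fun_eq_iff)
  have F: "F \<in> jets" using f by (simp add: F_eq jets_add jets_coord)
  have "dd v f = 0" if "v \<notin> Ju ` {..<n}" for v
    using pd_eq_0_if_depends_only[OF assms(10) that] by (auto simp: dd_def fun_eq_iff)
  then have dd_F: "dd v F = (if v = Ju n then const_on 1 else 0)" if "v \<notin> Ju ` {..<n}" for v
    using that f by (simp add: F_eq dd_add jets_coord dd_coord)
  have symmetries: "symmetries M F = symmetry_jets F"
    using symmetries_eq[OF F] by (simp add: symmetry_jets_def)
  \<comment> \<open>One statement for an arbitrary exponent set containing 0; the two parts are its
    instances \<open>{0}\<close> and \<open>UNIV\<close>.\<close>
  have quasi_span: "\<exists>g\<in>quasi_span \<Lambda>. \<forall>p\<in>M. G p = g p"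
    if "0 \<in> \<Lambda>" and G: "G \<in> symmetries M F"
      and low: "\<forall>G\<in>symmetries_upto M F (n - 1). \<exists>g\<in>quasi_span \<Lambda>. \<forall>p\<in>M. G p = g p" for \<Lambda> G
  proof -
    have "annihilated \<Lambda> G"
    proof (rule symmetry_annihilated[OF assms(1) F])
      show "dd Jx F = 0" "dd Jt F = 0" "dd (Ju n) F = const_on 1"
        by (simp_all add: dd_F image_iff)
      show "dd (Ju s) F = 0" if "n < s" for s
        using that by (simp add: dd_F image_iff)
      show "annihilated \<Lambda> H" if H: "H \<in> symmetry_jets F" "\<And>s. n \<le> s \<Longrightarrow> dd (Ju s) H = 0" for H
      proof -
        \<comment> \<open>Vanishing from index \<open>n\<close> on is the same as vanishing above n
          - 1, the form \<open>jet_ord_le\<close> asks for.\<close>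
        have "jet_ord M H \<le> n - 1"
          by (rule jet_ord_le, rule H(2)) simp
        then have "H \<in> symmetries_upto M F (n - 1)"
          using H(1) by (simp add: symmetries_upto_def symmetries)
        then obtain g where "g \<in> quasi_span \<Lambda>" "\<forall>p\<in>M. H p = g p" using low by blast
        then show ?thesis
          using annihilated_cong[OF quasi_span_annihilated \<open>0 \<in> \<Lambda>\<close>, of g H] by simp
      qed
      show "0 \<in> \<Lambda>" "G \<in> symmetry_jets F" using that by (simp_all add: symmetries)
    qed
    then show ?thesis
      using G by (intro annihilated_imp_quasi_span[OF time]) (auto simp: symmetries symmetry_jets_def)
  qed
  show ?thesis
    unfolding polynomial_in_t_iff quasipolynomial_combination_in_t_iff
    using quasi_span[of "{0}"] quasi_span[of UNIV] by simp
qed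

end
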